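(* For every non-negative integer $k$ there exists a $2$-connected graph $G$ with fault cost $\varphi(G)=k$.
   Context: Graphs are finite, simple and undirected. A graph is hamiltonian if it contains a cycle through all its vertices ($K_1$, $K_2$ are not hamiltonian). The minimum leaf number ${\rm ml}(G)$ is $1$ if $G$ is hamiltonian, $\infty$ if $G$ is disconnected, and otherwise the minimum number of leaves (degree-$1$ vertices) of a spanning tree of $G$. An ml-subgraph of $G$ is a hamiltonian cycle of $G$ if $G$ is hamiltonian, and otherwise a spanning tree of $G$ with exactly ${\rm ml}(G)$ leaves; ${\cal S}_{\rm ml}(G)$ denotes the set of ml-subgraphs of $G$. For an ml-subgraph $S$ of $G$, a vertex $v$, and an ml-subgraph $S_v$ of $G-v$, let $\tau(S,S_v)=|\{w\in V(G)\setminus\{v\}:\deg_S(w)\neq\deg_{S_v}(w)\}|$. Let $\varphi_S(G)=\max_{v\in V(G)}\min_{S_v\in{\cal S}_{\rm ml}(G-v)}\tau(S,S_v)$ and the fault cost $\varphi(G)=\min_{S\in{\cal S}_{\rm ml}(G)}\varphi_S(G)$. *)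

theory Defs
  imports Main "HOL-Library.Extended_Nat"
begin

datatype 'a ugraph = UGraph (verts: "'a set") (edges: "'a set set")

definition simple_graph :: "'a ugraph \<Rightarrow> bool" where
  "simple_graph G \<longleftrightarrow> finite (verts G) \<and> (\<forall>e\<in>edges G. e \<subseteq> verts G \<and> card e = 2)"

definition subgraph :: "'a ugraph \<Rightarrow> 'a ugraph \<Rightarrow> bool" where
  "subgraph H G \<longleftrightarrow> simple_graph H \<and> verts H \<subseteq> verts G \<and> edges H \<subseteq> edges G"

definition deg :: "'a ugraph \<Rightarrow> 'a \<Rightarrow> nat" where
  "deg G v = card {e \<in> edges G. v \<in> e}"

definition connected_graph :: "'a ugraph \<Rightarrow> bool" where
  "connected_graph G \<longleftrightarrow> verts G \<noteq> {} \<and>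
     (\<forall>u\<in>verts G. \<forall>v\<in>verts G. (u, v) \<in> {(x, y). {x, y} \<in> edges G}\<^sup>*)"

definition delete_verts :: "'a ugraph \<Rightarrow> 'a set \<Rightarrow> 'a ugraph" where
  "delete_verts G X = UGraph (verts G - X) {e \<in> edges G. e \<inter> X = {}}"

definition k_connected :: "nat \<Rightarrow> 'a ugraph \<Rightarrow> bool" where
  "k_connected k G \<longleftrightarrow> card (verts G) > k \<and>
     (\<forall>X. X \<subseteq> verts G \<and> card X < k \<longrightarrow> connected_graph (delete_verts G X))"

definition cycle_graph :: "'a ugraph \<Rightarrow> bool" where
  "cycle_graph C \<longleftrightarrow> (\<exists>vs. distinct vs \<and> length vs \<ge> 3 \<and> verts C = set vs \<and>
     edges C = {{vs ! i, vs ! (Suc i mod length vs)} | i. i < length vs})"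

definition hamiltonian_cycle :: "'a ugraph \<Rightarrow> 'a ugraph \<Rightarrow> bool" where
  "hamiltonian_cycle C G \<longleftrightarrow> cycle_graph C \<and> subgraph C G \<and> verts C = verts G"

definition hamiltonian :: "'a ugraph \<Rightarrow> bool" where
  "hamiltonian G \<longleftrightarrow> (\<exists>C. hamiltonian_cycle C G)"

definition tree_graph :: "'a ugraph \<Rightarrow> bool" where
  "tree_graph T \<longleftrightarrow> simple_graph T \<and> connected_graph T \<and> \<not> (\<exists>C. cycle_graph C \<and> subgraph C T)"

definition spanning_tree :: "'a ugraph \<Rightarrow> 'a ugraph \<Rightarrow> bool" where
  "spanning_tree T G \<longleftrightarrow> tree_graph T \<and> subgraph T G \<and> verts T = verts G"

definition leaves :: "'a ugraph \<Rightarrow> 'a set" where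
  "leaves T = {v \<in> verts T. deg T v = 1}"

definition min_leaf_number :: "'a ugraph \<Rightarrow> enat" where
  "min_leaf_number G =
     (if hamiltonian G then 1
      else if \<not> connected_graph G then \<infinity>
      else (INF T\<in>{T. spanning_tree T G}. enat (card (leaves T))))"

definition ml_subgraphs :: "'a ugraph \<Rightarrow> 'a ugraph set" where
  "ml_subgraphs G =
     (if hamiltonian G then {C. hamiltonian_cycle C G}
      else {T. spanning_tree T G \<and> enat (card (leaves T)) = min_leaf_number G})"

definition transition_cost :: "'a ugraph \<Rightarrow> 'a \<Rightarrow> 'a ugraph \<Rightarrow> 'a ugraph \<Rightarrow> nat" where
  "transition_cost G v S S_v = card {w \<in> verts G - {v}. deg S w \<noteq> deg S_v w}"

(* The maxima and minima below are written as SUP and INF in enat, where the infimum of the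
   empty set is infinity and every infimum of a nonempty set is attained. For a 2-connected
   graph all index sets are finite and nonempty, so these are genuine maxima and minima. *)

definition fault_cost_wrt :: "'a ugraph \<Rightarrow> 'a ugraph \<Rightarrow> enat" where
  "fault_cost_wrt S G =
     (SUP v\<in>verts G. INF S_v\<in>ml_subgraphs (delete_verts G {v}). enat (transition_cost G v S S_v))"

definition fault_cost :: "'a ugraph \<Rightarrow> enat" where
  "fault_cost G = (INF S\<in>ml_subgraphs G. fault_cost_wrt S G)"

end

(*
The costs 0 and 2 are realised by K_4 and K_3.

For cost at least 3 take n >= 2 blades: blade i consists of two paths Top - Tip i s - Arm i s - Hub
(s = True, False) and the edge joining its two arms. Every blade that loses no vertex contains a leaf
of every spanning tree, since otherwise its vertices together with Top (and Hub) carry a cycle, and n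
leaves suffice. Without Top all 2n tips are leaves, so at least n tips change degree when Top fails;
a degree count at Hub and at the arms shows that something else changes too. All other failures cost
at most 2, so the fault cost is n + 1.

For cost 1, a graph with a spanning path but without a hamiltonian cycle costs at least 1, because an
end of the path may fail. Conversely it suffices to find a non-hamiltonian graph G with a spanning path
from x to y such that no G - v is hamiltonian and G - v has a spanning path from x to y whenever v is
neither x nor y. Two copies of a 9-vertex fragment joined by two edges do this: a hamiltonian cycle cannot traverse an
intact fragment, and any single deletion leaves one of the two copies intact.
*)
theory Submission
  imports Defs "HOL-Library.Countable_Set"
begin

text \<open>The fragment comes from the Petersen graph. Delete a vertex, let \<open>a8\<close> be
  one of its neighbours, and join the two remaining neighbours \<open>a4\<close>, \<open>a5\<close>
  of \<open>a8\<close>; the other two neighbours \<open>a6\<close>, \<open>a7\<close> of the deleted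
  vertex carry the links to the other copy. As \<open>a8\<close> has degree 2, a cycle that
  traverses the fragment contains \<open>a4 - a8 - a5\<close>, hence not the added edge, and its
  passage from \<open>a6\<close> to \<open>a7\<close> would close up through the deleted vertex to a
  hamiltonian cycle of the Petersen graph. The added edge lets a spanning path begin
  \<open>a8, a4, a5\<close>.

  For windmills the obstacle is that costs compare optimal trees only, so the leaf number must be
  known exactly after every deletion. A blade that has lost a tip or an arm may have fewer leaves
  than the count asks for. It then carries a path of the tree from \<open>Top\<close> to
  \<open>Hub\<close>; no second blade can do so without closing a cycle, and this forces the missing
  leaf elsewhere. The same exclusion bounds the degrees at \<open>Hub\<close> and at the arms of an
  optimal tree of the intact windmill.\<close>

section \<open>Invariance under isomorphism\<close>

text \<open>\<open>nth\<close> may read past the end of a list and is not parametric, whereas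
  \<open>zip\<close>, \<open>tl\<close>, \<open>take\<close> and append are, so this form can be
  transferred. \<open>take 1 vs\<close> stands for the singleton of the head and stays parametric on
  the empty list.\<close>

lemma cycle_graph_iff_zip:
  "cycle_graph C \<longleftrightarrow> (\<exists>vs. distinct vs \<and> length vs \<ge> 3 \<and> verts C = set vs \<and>
     edges C = (\<lambda>(x, y). {x, y}) ` set (zip vs (tl vs @ take 1 vs)))"
proof -
  have "{{vs ! i, vs ! (Suc i mod length vs)} | i. i < length vs}
      = (\<lambda>(x, y). {x, y}) ` set (zip vs (tl vs @ take 1 vs))" if "length vs \<ge> 3" for vs :: "'a list"
  proof -
    have "(tl vs @ take 1 vs) ! i = vs ! (Suc i mod length vs)" if "i < length vs" for i
    proof (cases "Suc i < length vs")
      case True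
      then show ?thesis using that by (auto simp: nth_append nth_tl)
    next
      case False
      with that have "i = length vs - 1" by simp
      then show ?thesis using \<open>length vs \<ge> 3\<close> by (cases vs) (auto simp: nth_append)
    qed
    moreover have "length (tl vs @ take 1 vs) = length vs" using that by simp
    ultimately have *: "set (zip vs (tl vs @ take 1 vs)) = (\<lambda>i. (vs ! i, vs ! (Suc i mod length vs))) ` {..<length vs}"
      unfolding set_zip by (auto simp: image_iff)
    show ?thesis unfolding * by (auto simp: image_iff)
  qed
  then show ?thesis unfolding cycle_graph_def by (metis (no_types, lifting))
qed

text \<open>The powerset is not a bounded functor, so the vertex type is a dead parameter of the
  datatype and the relator is given explicitly.\<close>

definition rel_ugraph :: "('a \<Rightarrow> 'b \<Rightarrow> bool) \<Rightarrow> 'a ugraph \<Rightarrow> 'b ugraph \<Rightarrow> bool" where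
  "rel_ugraph A G H \<longleftrightarrow> rel_set A (verts G) (verts H) \<and> rel_set (rel_set A) (edges G) (edges H)"

context
  fixes A :: "'a \<Rightarrow> 'b \<Rightarrow> bool"
  assumes bi_unique [transfer_rule]: "bi_unique A"
    and bi_total [transfer_rule]: "bi_total A"
begin

context includes lifting_syntax
begin

lemma verts_transfer [transfer_rule]: "(rel_ugraph A ===> rel_set A) verts verts"
  by (auto simp: rel_fun_def rel_ugraph_def)

lemma edges_transfer [transfer_rule]: "(rel_ugraph A ===> rel_set (rel_set A)) edges edges"
  by (auto simp: rel_fun_def rel_ugraph_def)

lemma UGraph_transfer [transfer_rule]:
  "(rel_set A ===> rel_set (rel_set A) ===> rel_ugraph A) UGraph UGraph"
  by (auto simp: rel_fun_def rel_ugraph_def)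

lemma bi_unique_rel_ugraph [transfer_rule]: "bi_unique (rel_ugraph A)"
proof -
  have unique: "bi_unique (rel_set A)" "bi_unique (rel_set (rel_set A))"
    by (intro bi_unique_rel_set bi_unique)+
  have "H = H'" if "rel_ugraph A G H" "rel_ugraph A G H'" for G H H'
    using that bi_uniqueDr[OF unique(1), of "verts G" "verts H" "verts H'"]
      bi_uniqueDr[OF unique(2), of "edges G" "edges H" "edges H'"]
    by (cases H, cases H') (simp add: rel_ugraph_def)
  moreover have "G = G'" if "rel_ugraph A G H" "rel_ugraph A G' H" for G G' H
    using that bi_uniqueDl[OF unique(1), of "verts G" "verts H" "verts G'"]
      bi_uniqueDl[OF unique(2), of "edges G" "edges H" "edges G'"]
    by (cases G, cases G') (simp add: rel_ugraph_def)
  ultimately show ?thesis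
    unfolding bi_unique_def by blast
qed

text \<open>Cycles and spanning trees are quantified over all graphs, so totality is required on
  graphs and not only on vertices.\<close>

lemma bi_total_rel_ugraph [transfer_rule]: "bi_total (rel_ugraph A)"
proof -
  have total: "bi_total (rel_set A)" "bi_total (rel_set (rel_set A))"
    by (intro bi_total_rel_set bi_total)+
  have "\<exists>H. rel_ugraph A G H" for G
  proof -
    obtain V E where "rel_set A (verts G) V" "rel_set (rel_set A) (edges G) E"
      using total unfolding bi_total_def by blast
    then have "rel_ugraph A G (UGraph V E)" by (simp add: rel_ugraph_def)
    then show ?thesis ..
  qed
  moreover have "\<exists>G. rel_ugraph A G H" for H
  proof -
    obtain V E where "rel_set A V (verts H)" "rel_set (rel_set A) E (edges H)"
      using total unfolding bi_total_def by blast
    then have "rel_ugraph A (UGraph V E) H" by (simp add: rel_ugraph_def)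
    then show ?thesis ..
  qed
  ultimately show ?thesis
    unfolding bi_total_def by blast
qed

lemma simple_graph_transfer [transfer_rule]:
  "(rel_ugraph A ===> (=)) simple_graph simple_graph"
  unfolding simple_graph_def by transfer_prover

lemma subgraph_transfer [transfer_rule]:
  "(rel_ugraph A ===> rel_ugraph A ===> (=)) subgraph subgraph"
  unfolding subgraph_def by transfer_prover

lemma deg_transfer [transfer_rule]: "(rel_ugraph A ===> A ===> (=)) deg deg"
  unfolding deg_def by transfer_prover

lemma connected_graph_transfer [transfer_rule]:
  "(rel_ugraph A ===> (=)) connected_graph connected_graph"
  unfolding connected_graph_def by transfer_prover

lemma delete_verts_transfer [transfer_rule]:
  "(rel_ugraph A ===> rel_set A ===> rel_ugraph A) delete_verts delete_verts"
  unfolding delete_verts_def by transfer_prover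

lemma k_connected_transfer [transfer_rule]:
  "((=) ===> rel_ugraph A ===> (=)) k_connected k_connected"
  unfolding k_connected_def by transfer_prover

lemma cycle_graph_transfer [transfer_rule]:
  "(rel_ugraph A ===> (=)) cycle_graph cycle_graph"
  unfolding cycle_graph_iff_zip by transfer_prover

lemma hamiltonian_cycle_transfer [transfer_rule]:
  "(rel_ugraph A ===> rel_ugraph A ===> (=)) hamiltonian_cycle hamiltonian_cycle"
  unfolding hamiltonian_cycle_def by transfer_prover

lemma hamiltonian_transfer [transfer_rule]: "(rel_ugraph A ===> (=)) hamiltonian hamiltonian"
  unfolding hamiltonian_def by transfer_prover

lemma tree_graph_transfer [transfer_rule]: "(rel_ugraph A ===> (=)) tree_graph tree_graph"
  unfolding tree_graph_def by transfer_prover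

lemma spanning_tree_transfer [transfer_rule]:
  "(rel_ugraph A ===> rel_ugraph A ===> (=)) spanning_tree spanning_tree"
  unfolding spanning_tree_def by transfer_prover

lemma leaves_transfer [transfer_rule]: "(rel_ugraph A ===> rel_set A) leaves leaves"
  unfolding leaves_def by transfer_prover

lemma Inf_enat_transfer [transfer_rule]: "(rel_set (=) ===> (=)) (Inf :: enat set \<Rightarrow> _) Inf"
  unfolding rel_set_eq by transfer_prover

lemma Sup_enat_transfer [transfer_rule]: "(rel_set (=) ===> (=)) (Sup :: enat set \<Rightarrow> _) Sup"
  unfolding rel_set_eq by transfer_prover

lemma min_leaf_number_transfer [transfer_rule]:
  "(rel_ugraph A ===> (=)) min_leaf_number min_leaf_number"
  unfolding min_leaf_number_def by transfer_prover

lemma ml_subgraphs_transfer [transfer_rule]: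
  "(rel_ugraph A ===> rel_set (rel_ugraph A)) ml_subgraphs ml_subgraphs"
  unfolding ml_subgraphs_def by transfer_prover

lemma transition_cost_transfer [transfer_rule]:
  "(rel_ugraph A ===> A ===> rel_ugraph A ===> rel_ugraph A ===> (=)) transition_cost transition_cost"
  unfolding transition_cost_def by transfer_prover

lemma fault_cost_wrt_transfer [transfer_rule]:
  "(rel_ugraph A ===> rel_ugraph A ===> (=)) fault_cost_wrt fault_cost_wrt"
  unfolding fault_cost_wrt_def by transfer_prover

lemma fault_cost_transfer [transfer_rule]: "(rel_ugraph A ===> (=)) fault_cost fault_cost"
  unfolding fault_cost_def by transfer_prover

end

end

text \<open>Carries the windmills, whose vertices form their own datatype, over to the natural
  numbers. A bijection between the whole types makes the relation total on both sides.\<close>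

lemma fault_cost_transport:
  fixes G :: "'a ugraph" and f :: "'a \<Rightarrow> 'b"
  assumes "bij f" "simple_graph G" "k_connected m G" "fault_cost G = c"
  shows "\<exists>H :: 'b ugraph. simple_graph H \<and> k_connected m H \<and> fault_cost H = c"
proof -
  define R where "R = (\<lambda>x y. f x = y)"
  have [transfer_rule]: "bi_unique R" "bi_total R"
    using \<open>bij f\<close> unfolding R_def bi_unique_def bi_total_def by (auto dest: bij_is_inj bij_is_surj injD)
       (metis bij_is_surj surjD)
  have "\<exists>G :: 'a ugraph. simple_graph G \<and> k_connected m G \<and> fault_cost G = c"
    using assms by blast
  then show ?thesis by transfer
qed

section \<open>Neighbourhoods\<close>

definition nbrs :: "'a ugraph \<Rightarrow> 'a \<Rightarrow> 'a set" where
  "nbrs G v = {w. {v, w} \<in> edges G}"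

lemma nbrs_sym: "w \<in> nbrs G v \<longleftrightarrow> v \<in> nbrs G w"
  by (simp add: nbrs_def insert_commute)

lemma nbrs_symD: "w \<in> nbrs G v \<Longrightarrow> v \<in> nbrs G w"
  by (simp add: nbrs_sym)

lemma nbrs_verts:
  assumes "simple_graph G" "w \<in> nbrs G v"
  shows "v \<in> verts G" "w \<in> verts G" "w \<noteq> v"
  using assms by (fastforce simp: simple_graph_def nbrs_def)+

lemma finite_nbrs: "simple_graph G \<Longrightarrow> finite (nbrs G v)"
  by (rule finite_subset[of _ "verts G"]) (auto dest: nbrs_verts(2), auto simp: simple_graph_def)

lemma deg_eq_card_nbrs:
  assumes "simple_graph G"
  shows "deg G v = card (nbrs G v)"
proof -
  have "{e \<in> edges G. v \<in> e} = (\<lambda>w. {v, w}) ` nbrs G v"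
  proof (intro equalityI subsetI)
    fix e assume e: "e \<in> {e \<in> edges G. v \<in> e}"
    then have "card e = 2" using assms by (auto simp: simple_graph_def)
    then obtain x y where "e = {x, y}" by (auto simp: card_2_iff)
    with e have "e = {v, x} \<or> e = {v, y}" by auto
    with e show "e \<in> (\<lambda>w. {v, w}) ` nbrs G v" by (auto simp: nbrs_def)
  qed (auto simp: nbrs_def)
  moreover have "inj_on (\<lambda>w. {v, w}) (nbrs G v)"
    by (auto simp: inj_on_def doubleton_eq_iff)
  ultimately show ?thesis by (simp add: deg_def card_image)
qed

lemma subgraph_nbrs: "subgraph H G \<Longrightarrow> nbrs H v \<subseteq> nbrs G v"
  by (auto simp: subgraph_def nbrs_def)

lemma verts_delete_verts [simp]: "verts (delete_verts G X) = verts G - X"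
  by (simp add: delete_verts_def)

lemma nbrs_delete_verts: "nbrs (delete_verts G X) v = (if v \<in> X then {} else nbrs G v - X)"
  by (auto simp: delete_verts_def nbrs_def)

lemma simple_graph_delete_verts: "simple_graph G \<Longrightarrow> simple_graph (delete_verts G X)"
  by (auto simp: delete_verts_def simple_graph_def)

lemma delete_verts_disjoint:
  assumes "simple_graph G" "verts G \<inter> X = {}"
  shows "delete_verts G X = G"
  using assms by (cases G) (fastforce simp: delete_verts_def simple_graph_def)

text \<open>A walk cannot leave a set that contains all neighbours of its members. Separated pieces
  are refuted by this closure argument, without naming a path.\<close>

lemma connected_graph_closed:
  assumes "connected_graph G" "x \<in> U" "x \<in> verts G" "\<And>y. y \<in> U \<Longrightarrow> nbrs G y \<subseteq> U"
  shows "verts G \<subseteq> U"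
proof
  fix y assume "y \<in> verts G"
  then have "(x, y) \<in> {(x, y). {x, y} \<in> edges G}\<^sup>*"
    using assms by (auto simp: connected_graph_def)
  then show "y \<in> U"
    by (induction) (use assms in \<open>auto simp: nbrs_def\<close>)
qed

lemma connected_graph_nbrs_nonempty:
  assumes "connected_graph G" "v \<in> verts G" "verts G \<noteq> {v}"
  shows "nbrs G v \<noteq> {}"
  using connected_graph_closed[OF assms(1), of v "{v}"] assms(2,3) by auto

section \<open>Cycles\<close>

lemma cycle_graph_nbrs:
  assumes "cycle_graph C"
  obtains vs where "distinct vs" "length vs \<ge> 3" "verts C = set vs"
    "\<And>i. i < length vs \<Longrightarrow>
      nbrs C (vs ! i) = {vs ! (Suc i mod length vs), vs ! ((i + length vs - 1) mod length vs)}"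
proof -
  from assms obtain vs where vs: "distinct vs" "length vs \<ge> 3" "verts C = set vs"
    and E: "edges C = {{vs ! i, vs ! (Suc i mod length vs)} | i. i < length vs}"
    by (auto simp: cycle_graph_def)
  let ?n = "length vs"
  \<comment> \<open>Cyclic successor and predecessor are mutually inverse; adding \<open>?n\<close>
    before subtracting 1 avoids truncation at index 0.\<close>
  have prev: "Suc ((i + ?n - 1) mod ?n) mod ?n = i" "(Suc i mod ?n + ?n - 1) mod ?n = i" if "i < ?n" for i
    using that vs(2) by (cases i; auto simp: mod_Suc)+
  have "nbrs C (vs ! i) = {vs ! (Suc i mod ?n), vs ! ((i + ?n - 1) mod ?n)}" if i: "i < ?n" for i
  proof (intro equalityI subsetI)
    fix w assume "w \<in> nbrs C (vs ! i)"
    then obtain j where j: "j < ?n" "{vs ! i, w} = {vs ! j, vs ! (Suc j mod ?n)}"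
      by (auto simp: nbrs_def E)
    then consider "vs ! i = vs ! j" "w = vs ! (Suc j mod ?n)" | "vs ! i = vs ! (Suc j mod ?n)" "w = vs ! j"
      by (auto simp: doubleton_eq_iff)
    then show "w \<in> {vs ! (Suc i mod ?n), vs ! ((i + ?n - 1) mod ?n)}"
    proof cases
      case 1
      then show ?thesis using nth_eq_iff_index_eq[OF vs(1)] i j by auto
    next
      case 2
      have "Suc j mod ?n < ?n" using vs(2) by (intro mod_less_divisor) auto
      with 2 have "i = Suc j mod ?n" using nth_eq_iff_index_eq[OF vs(1)] i by auto
      then show ?thesis using 2 prev(2)[OF j(1)] by simp
    qed
  next
    fix w assume "w \<in> {vs ! (Suc i mod ?n), vs ! ((i + ?n - 1) mod ?n)}"
    moreover have "(i + ?n - 1) mod ?n < ?n" using vs(2) by (intro mod_less_divisor) auto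
    ultimately show "w \<in> nbrs C (vs ! i)"
      using prev(1)[OF i] i unfolding nbrs_def E by (force simp: insert_commute)
  qed
  with vs that show thesis by blast
qed

lemma cycle_graph_card_nbrs:
  assumes "cycle_graph C" "v \<in> verts C"
  shows "card (nbrs C v) = 2"
proof -
  obtain vs where vs: "distinct vs" "length vs \<ge> 3" "verts C = set vs"
    and nb: "\<And>i. i < length vs \<Longrightarrow>
      nbrs C (vs ! i) = {vs ! (Suc i mod length vs), vs ! ((i + length vs - 1) mod length vs)}"
    using cycle_graph_nbrs[OF assms(1)] by metis
  let ?n = "length vs"
  obtain i where i: "i < ?n" "v = vs ! i" using assms(2) vs(3) by (auto simp: in_set_conv_nth)
  have "Suc i mod ?n \<noteq> (i + ?n - 1) mod ?n"
    using i vs(2) by (cases i) (auto simp: mod_Suc)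
  moreover have "Suc i mod ?n < ?n" "(i + ?n - 1) mod ?n < ?n"
    using vs(2) by (auto intro!: mod_less_divisor)
  ultimately show ?thesis
    using nth_eq_iff_index_eq[OF vs(1)] by (simp add: nb i)
qed

text \<open>Iterating the cyclic successor from \<open>x\<close> reaches every vertex without
  leaving \<open>U\<close>. This is what rules out short cycles inside the fragment.\<close>

lemma cycle_graph_closed:
  assumes "cycle_graph C" "x \<in> U" "x \<in> verts C" "\<And>y. y \<in> U \<Longrightarrow> nbrs C y \<subseteq> U"
  shows "verts C \<subseteq> U"
proof -
  obtain vs where vs: "distinct vs" "length vs \<ge> 3" "verts C = set vs"
    and nb: "\<And>i. i < length vs \<Longrightarrow>
      nbrs C (vs ! i) = {vs ! (Suc i mod length vs), vs ! ((i + length vs - 1) mod length vs)}"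
    using cycle_graph_nbrs[OF assms(1)] by metis
  let ?n = "length vs"
  obtain i where i: "i < ?n" "x = vs ! i" using assms(3) vs(3) by (auto simp: in_set_conv_nth)
  have "vs ! ((i + k) mod ?n) \<in> U" for k
  proof (induction k)
    case (Suc k)
    have "(i + k) mod ?n < ?n" using vs(2) by (intro mod_less_divisor) auto
    from assms(4)[OF Suc] nb[OF this] show ?case by (simp add: mod_Suc_eq)
  qed (use i assms(2) in simp)
  note step = this
  show ?thesis
  proof
    fix y assume "y \<in> verts C"
    then obtain j where j: "j < ?n" "y = vs ! j" using vs(3) by (auto simp: in_set_conv_nth)
    \<comment> \<open>The number of steps from \<open>i\<close> to \<open>j\<close>, with
      \<open>?n\<close> added so that the subtraction does not truncate when
      \<open>j < i\<close>.\<close>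
    have "(i + (j + ?n - i)) mod ?n = j" using i j by simp
    with step[of "j + ?n - i"] j show "y \<in> U" by simp
  qed
qed

lemma hamiltonianE:
  assumes "hamiltonian G"
  obtains C where "simple_graph C" "cycle_graph C" "verts C = verts G"
    "\<And>v. nbrs C v \<subseteq> nbrs G v" "\<And>v. v \<in> verts G \<Longrightarrow> card (nbrs C v) = 2"
  using assms subgraph_nbrs cycle_graph_card_nbrs
  unfolding hamiltonian_def hamiltonian_cycle_def by (metis subgraph_def)

text \<open>The listed vertices with their closing edge form a cycle subgraph, so acyclicity can be
  contradicted by naming vertices in cyclic order.\<close>

lemma tree_graph_no_cycle:
  assumes "tree_graph T" "distinct vs" "length vs \<ge> 3"
    "successively (\<lambda>x y. y \<in> nbrs T x) vs" "hd vs \<in> nbrs T (last vs)"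
  shows False
proof -
  define C where "C = UGraph (set vs) {{vs ! i, vs ! (Suc i mod length vs)} | i. i < length vs}"
  have simple: "simple_graph T" using assms(1) by (simp add: tree_graph_def)
  have "{vs ! i, vs ! (Suc i mod length vs)} \<in> edges T" if "i < length vs" for i
  proof (cases "Suc i < length vs")
    case True
    then show ?thesis using assms(4) by (auto simp: successively_conv_nth nbrs_def)
  next
    case False
    with that have "i = length vs - 1" by simp
    moreover have "vs \<noteq> []" using assms(3) by auto
    ultimately have "Suc i mod length vs = 0" "vs ! i = last vs" using that by (auto simp: last_conv_nth)
    then show ?thesis using assms(5) \<open>vs \<noteq> []\<close> by (simp add: nbrs_def hd_conv_nth)
  qed
  then have sub: "edges C \<subseteq> edges T" by (auto simp: C_def)
  moreover have "verts C \<subseteq> verts T"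
  proof
    fix x assume "x \<in> verts C"
    then obtain i where "i < length vs" "x = vs ! i" by (auto simp: C_def in_set_conv_nth)
    then have "{x, vs ! (Suc i mod length vs)} \<in> edges T" using sub by (auto simp: C_def)
    then show "x \<in> verts T" using simple by (auto simp: simple_graph_def)
  qed
  moreover have "simple_graph C"
  proof -
    have "length vs > 0" using assms(3) by linarith
    then have "e \<subseteq> verts C" if "e \<in> edges C" for e
      using that by (auto simp: C_def)
    then show ?thesis using sub simple by (auto simp: simple_graph_def C_def)
  qed
  moreover have "cycle_graph C" using assms(2,3) by (auto simp: cycle_graph_def C_def)
  ultimately show False using assms(1) by (auto simp: tree_graph_def subgraph_def)
qed

section \<open>Trees\<close>

definition parent_tree :: "'a set \<Rightarrow> 'a \<Rightarrow> ('a \<Rightarrow> 'a) \<Rightarrow> 'a ugraph" where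
  "parent_tree V r p = UGraph V ((\<lambda>v. {v, p v}) ` (V - {r}))"

lemma verts_parent_tree [simp]: "verts (parent_tree V r p) = V"
  by (simp add: parent_tree_def)

lemma nbrs_parent_tree:
  "nbrs (parent_tree V r p) v = {w \<in> V - {r}. p w = v} \<union> (if v \<in> V - {r} then {p v} else {})"
  by (auto simp: nbrs_def parent_tree_def doubleton_eq_iff)

text \<open>Decreasing ranks lead every vertex to the root. On a cycle, a vertex of maximal rank has
  no neighbour but its parent, since a child would rank higher, so it cannot have degree 2.\<close>

lemma parent_tree:
  fixes rank :: "'a \<Rightarrow> nat"
  assumes "finite V" "r \<in> V" and p: "\<And>v. v \<in> V \<Longrightarrow> v \<noteq> r \<Longrightarrow> p v \<in> V \<and> rank (p v) < rank v"
  shows "tree_graph (parent_tree V r p)"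
proof -
  let ?T = "parent_tree V r p"
  have "p v \<noteq> v" if "v \<in> V - {r}" for v
    using p[of v] that by auto
  then have simple: "simple_graph ?T"
    using assms(1) p by (auto simp: simple_graph_def parent_tree_def card_2_iff)
  let ?R = "{(x, y). {x, y} \<in> edges ?T}"
  have to_root: "(v, r) \<in> ?R\<^sup>*" if "v \<in> V" for v
    using that
  proof (induction "rank v" arbitrary: v rule: less_induct)
    case less
    show ?case
    proof (cases "v = r")
      case False
      then have "(v, p v) \<in> ?R" using less.prems by (auto simp: parent_tree_def)
      moreover have "(p v, r) \<in> ?R\<^sup>*" using p[of v] False less by blast
      ultimately show ?thesis by (rule converse_rtrancl_into_rtrancl)
    qed simp
  qed
  have "sym (?R\<^sup>*)" by (intro sym_rtrancl) (auto simp: sym_def insert_commute)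
  then have "connected_graph ?T"
    using to_root assms(2) unfolding connected_graph_def by (auto dest: symD intro: rtrancl_trans)
  moreover have False if C: "cycle_graph C" "subgraph C ?T" for C
  proof -
    have "finite (verts C)" "verts C \<noteq> {}" and simpleC: "simple_graph C"
      using C by (auto simp: subgraph_def simple_graph_def cycle_graph_def)
    then have "Max (rank ` verts C) \<in> rank ` verts C" by simp
    then obtain v where v: "v \<in> verts C" "rank v = Max (rank ` verts C)" by auto
    then have max: "rank w \<le> rank v" if "w \<in> verts C" for w
      using that \<open>finite (verts C)\<close> by simp
    have "w = p v" if "w \<in> nbrs C v" for w
    proof -
      have "w \<in> nbrs ?T v" using subgraph_nbrs[OF C(2)] that by blast
      moreover have "rank w \<le> rank v" using max nbrs_verts(2)[OF simpleC that] by blast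
      ultimately show ?thesis using p[of w] by (auto simp: nbrs_parent_tree split: if_splits)
    qed
    then have "nbrs C v \<subseteq> {p v}" by blast
    then have "card (nbrs C v) \<le> 1" using card_mono[of "{p v}"] by fastforce
    then show False using cycle_graph_card_nbrs[OF C(1) v(1)] by simp
  qed
  ultimately show ?thesis using simple by (auto simp: tree_graph_def)
qed

lemma spanning_parent_tree:
  fixes rank :: "'a \<Rightarrow> nat"
  assumes "simple_graph G" "r \<in> verts G"
    and p: "\<And>v. v \<in> verts G \<Longrightarrow> v \<noteq> r \<Longrightarrow> p v \<in> nbrs G v \<and> rank (p v) < rank v"
  shows "spanning_tree (parent_tree (verts G) r p) G"
proof -
  have "tree_graph (parent_tree (verts G) r p)"
    by (rule parent_tree[where rank = rank])
       (use assms(1,2) p nbrs_verts(2)[OF assms(1)] in \<open>auto simp: simple_graph_def\<close>)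
  moreover have "edges (parent_tree (verts G) r p) \<subseteq> edges G"
    using p by (auto simp: parent_tree_def nbrs_def)
  ultimately show ?thesis by (auto simp: spanning_tree_def subgraph_def tree_graph_def)
qed

lemma spanning_treeD:
  assumes "spanning_tree T G"
  shows "tree_graph T" "simple_graph T" "connected_graph T" "verts T = verts G"
    "nbrs T v \<subseteq> nbrs G v"
  using assms subgraph_nbrs[of T G v] by (auto simp: spanning_tree_def tree_graph_def)

lemma spanning_tree_connected:
  assumes "spanning_tree T G"
  shows "connected_graph G"
proof -
  have "{(x, y). {x, y} \<in> edges T}\<^sup>* \<subseteq> {(x, y). {x, y} \<in> edges G}\<^sup>*"
    using assms by (intro rtrancl_mono) (auto simp: spanning_tree_def subgraph_def)
  then show ?thesis
    using assms by (auto simp: spanning_tree_def tree_graph_def connected_graph_def)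
qed

lemma mem_leaves: "simple_graph T \<Longrightarrow> v \<in> leaves T \<longleftrightarrow> v \<in> verts T \<and> card (nbrs T v) = 1"
  by (simp add: leaves_def deg_eq_card_nbrs)

lemma finite_leaves: "simple_graph T \<Longrightarrow> finite (leaves T)"
  by (simp add: leaves_def simple_graph_def)

lemma leaves_subsetI:
  assumes "spanning_tree T G" "\<And>x. x \<in> verts G \<Longrightarrow> card (nbrs T x) = 1 \<Longrightarrow> x \<in> L"
  shows "leaves T \<subseteq> L"
  using assms(2) spanning_treeD(2,4)[OF assms(1)] by (auto simp: mem_leaves)

lemma card_nbrs_nonleaf:
  assumes "tree_graph T" "v \<in> verts T" "v \<notin> leaves T" "verts T \<noteq> {v}"
  shows "card (nbrs T v) \<ge> 2"
proof -
  have T: "simple_graph T" "connected_graph T" using assms(1) by (auto simp: tree_graph_def)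
  then have "card (nbrs T v) \<noteq> 0"
    using connected_graph_nbrs_nonempty[OF T(2) assms(2,4)] finite_nbrs[of T v] by simp
  moreover have "card (nbrs T v) \<noteq> 1" using assms(2,3) mem_leaves[OF T(1)] by blast
  ultimately show ?thesis by linarith
qed

text \<open>A tree with at most \<open>m\<close> leaves and a lower bound \<open>m\<close> for all
  trees certify the minimum; every leaf number below is computed in this way.\<close>

lemma ml_subgraphs_eq:
  assumes "\<not> hamiltonian G" "spanning_tree T\<^sub>0 G" "card (leaves T\<^sub>0) \<le> m"
    and lower: "\<And>T. spanning_tree T G \<Longrightarrow> m \<le> card (leaves T)"
  shows "ml_subgraphs G = {T. spanning_tree T G \<and> card (leaves T) = m}"
proof -
  have "(INF T\<in>{T. spanning_tree T G}. enat (card (leaves T))) = enat m"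
    using assms by (intro antisym INF_greatest INF_lower2[of T\<^sub>0]) auto
  then show ?thesis
    using assms(1) spanning_tree_connected[OF assms(2)]
    by (simp add: ml_subgraphs_def min_leaf_number_def)
qed

lemma transition_cost_nbrs:
  assumes "simple_graph S" "simple_graph S'"
  shows "transition_cost G v S S' = card {w \<in> verts G - {v}. card (nbrs S w) \<noteq> card (nbrs S' w)}"
  using assms by (simp add: transition_cost_def deg_eq_card_nbrs)

section \<open>Fault cost\<close>

text \<open>A min-max certificate: one subgraph that answers every failure within \<open>k\<close>,
  and against each subgraph a failure that costs \<open>k\<close>. That failing vertex may depend on
  \<open>S\<close>, as it does for cost 1.\<close>

lemma fault_cost_eqI:
  assumes "S\<^sub>0 \<in> ml_subgraphs G"
    and "\<And>v. v \<in> verts G \<Longrightarrow> \<exists>S'\<in>ml_subgraphs (delete_verts G {v}). transition_cost G v S\<^sub>0 S' \<le> k"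
    and "\<And>S. S \<in> ml_subgraphs G \<Longrightarrow>
      \<exists>v\<in>verts G. \<forall>S'\<in>ml_subgraphs (delete_verts G {v}). k \<le> transition_cost G v S S'"
  shows "fault_cost G = enat k"
proof (rule antisym)
  have "fault_cost_wrt S\<^sub>0 G \<le> enat k"
    unfolding fault_cost_wrt_def
  proof (rule SUP_least)
    fix v assume "v \<in> verts G"
    with assms(2) obtain S' where "S' \<in> ml_subgraphs (delete_verts G {v})" "transition_cost G v S\<^sub>0 S' \<le> k"
      by blast
    then show "(INF S'\<in>ml_subgraphs (delete_verts G {v}). enat (transition_cost G v S\<^sub>0 S')) \<le> enat k"
      by (intro INF_lower2[of S']) auto
  qed
  then show "fault_cost G \<le> enat k"
    unfolding fault_cost_def using assms(1) by (rule INF_lower2[rotated])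
  show "enat k \<le> fault_cost G"
    unfolding fault_cost_def
  proof (rule INF_greatest)
    fix S assume "S \<in> ml_subgraphs G"
    with assms(3) obtain v where v: "v \<in> verts G"
      "\<forall>S'\<in>ml_subgraphs (delete_verts G {v}). k \<le> transition_cost G v S S'"
      by blast
    show "enat k \<le> fault_cost_wrt S G"
      unfolding fault_cost_wrt_def
      by (rule SUP_upper2[OF v(1)], rule INF_greatest) (use v(2) in auto)
  qed
qed

lemma two_connectedI:
  assumes "simple_graph G" "card (verts G) > 2" "connected_graph G"
    and "\<And>v. v \<in> verts G \<Longrightarrow> connected_graph (delete_verts G {v})"
  shows "k_connected 2 G"
  unfolding k_connected_def
proof (intro conjI allI impI)
  fix X assume X: "X \<subseteq> verts G \<and> card X < 2"
  then have "finite X" using assms(1) finite_subset by (auto simp: simple_graph_def)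
  with X have "X = {} \<or> (\<exists>v. X = {v})"
    by (metis One_nat_def card_0_eq card_1_singletonE less_2_cases)
  then show "connected_graph (delete_verts G X)"
    using assms(3,4) X delete_verts_disjoint[OF assms(1), of "{}"] by auto
qed (use assms(2) in simp)

section \<open>Fault costs 0 and 2: complete graphs\<close>

definition complete_graph :: "'a set \<Rightarrow> 'a ugraph" where
  "complete_graph V = UGraph V {e. e \<subseteq> V \<and> card e = 2}"

lemma verts_complete_graph [simp]: "verts (complete_graph V) = V"
  by (simp add: complete_graph_def)

lemma nbrs_complete_graph: "nbrs (complete_graph V) v = (if v \<in> V then V - {v} else {})"
  by (auto simp: nbrs_def complete_graph_def card_2_iff)

lemma simple_complete_graph: "finite V \<Longrightarrow> simple_graph (complete_graph V)"
  by (auto simp: simple_graph_def complete_graph_def)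

lemma delete_verts_complete_graph: "delete_verts (complete_graph V) X = complete_graph (V - X)"
  by (auto simp: delete_verts_def complete_graph_def)

lemma connected_complete_graph:
  assumes "V \<noteq> {}"
  shows "connected_graph (complete_graph V)"
proof -
  have "{u, v} \<in> edges (complete_graph V)" if "u \<in> V" "v \<in> V" "u \<noteq> v" for u v
    using that by (auto simp: complete_graph_def)
  then show ?thesis
    using assms unfolding connected_graph_def by (auto intro: r_into_rtrancl)
qed

lemma hamiltonian_complete_graph:
  assumes "finite V" "card V \<ge> 3"
  shows "hamiltonian (complete_graph V)"
proof -
  obtain vs where vs: "set vs = V" "distinct vs" "length vs = card V"
    using assms(1) finite_distinct_list distinct_card by metis
  define C where "C = UGraph (set vs) {{vs ! i, vs ! (Suc i mod length vs)} | i. i < length vs}"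
  have "{vs ! i, vs ! (Suc i mod length vs)} \<in> edges (complete_graph V)" if "i < length vs" for i
  proof -
    have "Suc i mod length vs < length vs" "Suc i mod length vs \<noteq> i"
      using that vs(3) assms(2) by (auto simp: mod_Suc)
    then have "vs ! i \<noteq> vs ! (Suc i mod length vs)" "vs ! i \<in> V" "vs ! (Suc i mod length vs) \<in> V"
      using that vs(1) nth_eq_iff_index_eq[OF vs(2)] by auto
    then show ?thesis by (simp add: complete_graph_def)
  qed
  then have "edges C \<subseteq> edges (complete_graph V)" by (auto simp: C_def)
  then have "subgraph C (complete_graph V)" "verts C = V"
    using vs(1) by (auto simp: subgraph_def simple_graph_def complete_graph_def C_def)
  moreover have "cycle_graph C"
    using vs assms(2) unfolding cycle_graph_def C_def by (intro exI[of _ vs]) simp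
  ultimately show ?thesis
    by (auto simp: hamiltonian_def hamiltonian_cycle_def)
qed

lemma k_connected_complete_graph:
  assumes "finite V" "card V > k"
  shows "k_connected k (complete_graph V)"
proof -
  have "V - X \<noteq> {}" if "X \<subseteq> V" "card X < k" for X
    using that assms by auto
  then show ?thesis
    using assms unfolding k_connected_def delete_verts_complete_graph
    by (auto intro!: connected_complete_graph)
qed

text \<open>All degrees in a hamiltonian cycle are equal, so changing from one such cycle to another
  is free. This gives cost 0 when the graph and all its vertex-deleted subgraphs are
  hamiltonian.\<close>

lemma ml_subgraphs_hamiltonian:
  assumes "hamiltonian G" "S \<in> ml_subgraphs G" "v \<in> verts G"
  shows "deg S v = 2"
proof -
  have "hamiltonian_cycle S G" using assms by (simp add: ml_subgraphs_def)
  then show ?thesis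
    using assms(3) cycle_graph_card_nbrs[of S v] deg_eq_card_nbrs[of S v]
    by (simp add: hamiltonian_cycle_def subgraph_def)
qed

lemma hamiltonian_ml_subgraphs_nonempty:
  assumes "hamiltonian G"
  shows "ml_subgraphs G \<noteq> {}"
  using assms by (auto simp: ml_subgraphs_def hamiltonian_def)

lemma fault_cost_complete_graph_4:
  assumes "card V = 4"
  shows "fault_cost (complete_graph V) = enat 0"
proof -
  have fin: "finite V" using assms by (intro card_ge_0_finite) simp
  have ham: "hamiltonian (complete_graph V)"
    using fin assms by (intro hamiltonian_complete_graph) auto
  have ham': "hamiltonian (complete_graph (V - {v}))" if "v \<in> V" for v
    using fin assms that by (intro hamiltonian_complete_graph) auto
  obtain S where S: "S \<in> ml_subgraphs (complete_graph V)"
    using hamiltonian_ml_subgraphs_nonempty[OF ham] by blast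
  show ?thesis
  proof (rule fault_cost_eqI[OF S])
    fix v assume "v \<in> verts (complete_graph V)"
    then have h: "hamiltonian (complete_graph (V - {v}))" by (simp add: ham')
    then obtain S' where S': "S' \<in> ml_subgraphs (complete_graph (V - {v}))"
      using hamiltonian_ml_subgraphs_nonempty by blast
    have "deg S w = deg S' w" if "w \<in> V - {v}" for w
      using ml_subgraphs_hamiltonian[OF ham S, of w] ml_subgraphs_hamiltonian[OF h S', of w] that
      by simp
    then have "{w \<in> V - {v}. deg S w \<noteq> deg S' w} = {}" by blast
    then have "transition_cost (complete_graph V) v S S' = 0"
      unfolding transition_cost_def by (simp only: verts_complete_graph card.empty)
    then show "\<exists>S'\<in>ml_subgraphs (delete_verts (complete_graph V) {v}).
        transition_cost (complete_graph V) v S S' \<le> 0"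
      using S' by (auto simp: delete_verts_complete_graph)
  qed (use assms in \<open>auto simp: ex_in_conv\<close>)
qed

text \<open>After any deletion a single edge remains. Both of its ends drop from degree 2 to degree
  1, so every choice of subgraphs and of the failing vertex costs exactly 2.\<close>

lemma fault_cost_complete_graph_3:
  assumes "card V = 3"
  shows "fault_cost (complete_graph V) = enat 2"
proof -
  have fin: "finite V" using assms by (intro card_ge_0_finite) simp
  have ham: "hamiltonian (complete_graph V)"
    using fin assms by (intro hamiltonian_complete_graph) auto
  obtain S where S: "S \<in> ml_subgraphs (complete_graph V)"
    using hamiltonian_ml_subgraphs_nonempty[OF ham] by blast
  have nonempty: "ml_subgraphs (complete_graph (V - {v})) \<noteq> {}"
    and cost: "\<And>S S'. S \<in> ml_subgraphs (complete_graph V) \<Longrightarrow>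
      S' \<in> ml_subgraphs (complete_graph (V - {v})) \<Longrightarrow>
      transition_cost (complete_graph V) v S S' = 2" if v: "v \<in> V" for v
  proof -
    let ?G = "complete_graph (V - {v})"
    have card: "card (V - {v}) = 2" using assms v fin by simp
    have simple: "simple_graph ?G" using fin by (simp add: simple_complete_graph)
    \<comment> \<open>The bound both excludes a hamiltonian cycle on two vertices and makes both of
      them leaves of any spanning tree.\<close>
    have le1: "card (nbrs H w) \<le> 1" if "\<And>w. nbrs H w \<subseteq> nbrs ?G w" for H w
    proof -
      have "card (nbrs H w) \<le> card (nbrs ?G w)"
        using that finite_nbrs[OF simple] by (intro card_mono) auto
      also have "\<dots> \<le> 1" using card fin by (auto simp: nbrs_complete_graph)
      finally show ?thesis .
    qed
    have nonham: "\<not> hamiltonian ?G"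
    proof
      assume "hamiltonian ?G"
      then obtain C where C: "\<And>w. nbrs C w \<subseteq> nbrs ?G w" "\<And>w. w \<in> verts ?G \<Longrightarrow> card (nbrs C w) = 2"
        by (rule hamiltonianE) blast
      obtain w where "w \<in> V - {v}" using card by (metis card.empty equals0I zero_neq_numeral)
      then show False using C(2)[of w] le1[OF C(1), of w] by simp
    qed
    obtain x y where xy: "V - {v} = {x, y}" "x \<noteq> y" using card by (auto simp: card_2_iff)
    have tree: "spanning_tree (parent_tree (verts ?G) x (\<lambda>_. x)) ?G"
      by (rule spanning_parent_tree[OF simple, where rank = "\<lambda>w. if w = x then 0 else 1"])
         (use xy in \<open>auto simp: nbrs_complete_graph\<close>)
    have leaf: "leaves T = V - {v}" if T: "spanning_tree T ?G" for T
    proof -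
      have "w \<in> leaves T" if "w \<in> V - {v}" for w
      proof (rule ccontr)
        assume "w \<notin> leaves T"
        moreover have "V - {v} \<noteq> {w}" using card by (metis card_1_singleton_iff One_nat_def Suc_1 n_not_Suc_n)
        ultimately have "card (nbrs T w) \<ge> 2"
          using card_nbrs_nonleaf[OF spanning_treeD(1)[OF T], of w] that spanning_treeD(4)[OF T] by simp
        then show False using le1[OF spanning_treeD(5)[OF T], of w] by simp
      qed
      then show ?thesis using spanning_treeD(4)[OF T] by (auto simp: leaves_def)
    qed
    have ml: "ml_subgraphs ?G = {T. spanning_tree T ?G \<and> card (leaves T) = 2}"
      by (rule ml_subgraphs_eq[OF nonham tree]) (use leaf tree card in auto)
    then show "ml_subgraphs ?G \<noteq> {}" using tree leaf[OF tree] card by auto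
    fix S S' assume S: "S \<in> ml_subgraphs (complete_graph V)" and S': "S' \<in> ml_subgraphs ?G"
    have "deg S w \<noteq> deg S' w" if "w \<in> V - {v}" for w
    proof -
      have "w \<in> leaves S'" using leaf[of S'] S' ml that by simp
      then show ?thesis using ml_subgraphs_hamiltonian[OF ham S, of w] that by (simp add: leaves_def)
    qed
    then have "{w \<in> V - {v}. deg S w \<noteq> deg S' w} = V - {v}" by blast
    then show "transition_cost (complete_graph V) v S S' = 2"
      using card by (simp add: transition_cost_def)
  qed
  have "V \<noteq> {}" using assms by auto
  show ?thesis
  proof (rule fault_cost_eqI[OF S])
    fix v assume v: "v \<in> verts (complete_graph V)"
    then obtain S' where "S' \<in> ml_subgraphs (complete_graph (V - {v}))"
      using nonempty by fastforce
    then show "\<exists>S'\<in>ml_subgraphs (delete_verts (complete_graph V) {v}).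
        transition_cost (complete_graph V) v S S' \<le> 2"
      using cost[OF _ S] v by (auto simp: delete_verts_complete_graph intro!: bexI[of _ S'])
  next
    fix S assume "S \<in> ml_subgraphs (complete_graph V)"
    then show "\<exists>v\<in>verts (complete_graph V).
        \<forall>S'\<in>ml_subgraphs (delete_verts (complete_graph V) {v}). 2 \<le> transition_cost (complete_graph V) v S S'"
      using \<open>V \<noteq> {}\<close> cost by (auto simp: delete_verts_complete_graph ex_in_conv[symmetric])
  qed
qed

section \<open>Fault cost 1\<close>

text \<open>A further neighbour of the first vertex would either prolong the path or, lying on it,
  close a cycle with an initial segment.\<close>

lemma tree_longest_path_hd_leaf:
  assumes T: "tree_graph T" and vs: "distinct vs" "successively (\<lambda>x y. y \<in> nbrs T x) vs" "length vs \<ge> 2"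
    and longest: "\<And>ws. distinct ws \<Longrightarrow> successively (\<lambda>x y. y \<in> nbrs T x) ws \<Longrightarrow> length ws \<le> length vs"
  shows "hd vs \<in> leaves T"
proof -
  have simple: "simple_graph T" using T by (simp add: tree_graph_def)
  obtain x y zs where eq: "vs = x # y # zs" using vs(3) by (auto simp: numeral_2_eq_2 Suc_le_length_iff)
  then have y: "y \<in> nbrs T x" using vs(2) by simp
  have "w = y" if w: "w \<in> nbrs T x" for w
  proof (rule ccontr)
    assume "w \<noteq> y"
    have "w \<in> set vs"
    proof (rule ccontr)
      assume "w \<notin> set vs"
      then show False
        using longest[of "w # vs"] vs w by (simp add: eq nbrs_sym[of x])
    qed
    moreover have "w \<noteq> x" using nbrs_verts(3)[OF simple w] .
    ultimately have "w \<in> set zs" using \<open>w \<noteq> y\<close> eq by simp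
    then obtain as bs where "zs = as @ w # bs" by (auto simp: in_set_conv_decomp)
    then have "vs = (x # y # as @ [w]) @ bs" by (simp add: eq)
    then have "distinct (x # y # as @ [w])" "successively (\<lambda>x y. y \<in> nbrs T x) (x # y # as @ [w])"
      using vs(1,2) by (metis distinct_append, metis successively_append_iff)
    then show False
      using tree_graph_no_cycle[OF T, of "x # y # as @ [w]"] w by (simp add: nbrs_sym[of x])
  qed
  then have "nbrs T x = {y}" using y by blast
  then show ?thesis using mem_leaves[OF simple] nbrs_verts(1)[OF simple y] eq by simp
qed

text \<open>Both ends of a longest path are leaves; the second end is treated by reversing the
  path.\<close>

lemma tree_two_leaves:
  assumes T: "tree_graph T" and card: "card (verts T) \<ge> 2"
  shows "card (leaves T) \<ge> 2"
proof -
  let ?E = "\<lambda>x y. y \<in> nbrs T x"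
  \<comment> \<open>Singleton lists satisfy \<open>successively\<close> whatever their entry. From
    length 2 on, every entry has an adjacent one and so is a vertex of \<open>T\<close>, which
    bounds the length and makes a longest path exist.\<close>
  let ?P = "\<lambda>vs. distinct vs \<and> successively ?E vs \<and> length vs \<ge> 2"
  have simple: "simple_graph T" and conn: "connected_graph T"
    using T by (auto simp: tree_graph_def)
  then have fin: "finite (verts T)" by (simp add: simple_graph_def)
  have len: "length vs \<le> card (verts T)" if "?P vs" for vs
  proof -
    have "x \<in> verts T" if "x \<in> set vs" for x
    proof -
      obtain i where i: "i < length vs" "x = vs ! i" using \<open>x \<in> set vs\<close> by (metis in_set_conv_nth)
      show ?thesis
      proof (cases "Suc i < length vs")
        case True
        then show ?thesis using i \<open>?P vs\<close> nbrs_verts(1)[OF simple] by (auto simp: successively_conv_nth)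
      next
        case False
        then have "i = Suc (i - 1)" "Suc (i - 1) < length vs" using i \<open>?P vs\<close> by auto
        then show ?thesis
          using i \<open>?P vs\<close> nbrs_verts(2)[OF simple] by (metis successively_conv_nth)
      qed
    qed
    then have "set vs \<subseteq> verts T" by blast
    then have "card (set vs) \<le> card (verts T)" using fin by (rule card_mono[rotated])
    then show ?thesis using \<open>?P vs\<close> by (simp add: distinct_card)
  qed
  have "verts T \<noteq> {}" using conn by (simp add: connected_graph_def)
  then obtain v where v: "v \<in> verts T" "verts T \<noteq> {v}" using card by (metis card_1_singleton_iff
      Suc_1 Suc_n_not_le_n all_not_in_conv One_nat_def)
  then obtain w where w: "w \<in> nbrs T v" using connected_graph_nbrs_nonempty[OF conn] by blast
  then have "?P [v, w]" using nbrs_verts(3)[OF simple w] by auto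
  moreover have "\<forall>vs. ?P vs \<longrightarrow> length vs < Suc (card (verts T))" using len by (simp add: le_imp_less_Suc)
  ultimately obtain vs where vs: "?P vs" and max: "\<And>ws. ?P ws \<Longrightarrow> length ws \<le> length vs"
    using ex_has_greatest_nat[of ?P "[v, w]" length] by blast
  have longest: "length ws \<le> length vs" if "distinct ws" "successively ?E ws" for ws
    using max[of ws] that vs by (cases "length ws \<ge> 2") auto
  have "hd vs \<in> leaves T"
    using tree_longest_path_hd_leaf[OF T] vs longest by blast
  moreover have "hd (rev vs) \<in> leaves T"
    by (rule tree_longest_path_hd_leaf[OF T])
       (use vs longest in \<open>auto simp: nbrs_sym[of _ T] intro: successively_mono\<close>)
  moreover have "hd vs \<noteq> hd (rev vs)"
    using vs hd_rev[of vs] by (cases vs; cases "tl vs") auto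
  ultimately have "card {hd vs, hd (rev vs)} \<le> card (leaves T)"
    using finite_leaves[OF simple] by (intro card_mono) auto
  then show ?thesis using \<open>hd vs \<noteq> hd (rev vs)\<close> by simp
qed

lemma spanning_path:
  assumes G: "simple_graph G" and vs: "distinct vs" "set vs = verts G" "length vs \<ge> 2"
    and succ: "successively (\<lambda>x y. y \<in> nbrs G x) vs"
  obtains T where "spanning_tree T G"
    "\<forall>v\<in>verts G. card (nbrs T v) = (if v = hd vs \<or> v = last vs then 1 else 2)"
proof -
  \<comment> \<open>The position on the path serves as rank, and the parent of a vertex is its
    predecessor.\<close>
  define idx where "idx = inv_into {..<length vs} ((!) vs)"
  define T where "T = parent_tree (verts G) (vs ! 0) (\<lambda>v. vs ! (idx v - 1))"
  have ne: "vs \<noteq> []" using vs(3) by auto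
  have idx: "idx (vs ! i) = i" if "i < length vs" for i
    unfolding idx_def using that vs(1) by (intro inv_into_f_f) (auto simp: inj_on_nth)
  have verts: "\<exists>i<length vs. v = vs ! i" if "v \<in> verts G" for v
    using that vs(2) by (metis in_set_conv_nth)
  have eq: "vs ! i = vs ! j \<longleftrightarrow> i = j" if "i < length vs" "j < length vs" for i j
    using nth_eq_iff_index_eq[OF vs(1)] that by blast
  have "spanning_tree T G"
    unfolding T_def
  proof (rule spanning_parent_tree[OF G, where rank = idx])
    show "vs ! 0 \<in> verts G" using nth_mem[of 0 vs] ne vs(2) by simp
  next
    fix v assume "v \<in> verts G" "v \<noteq> vs ! 0"
    then obtain i where i: "Suc i < length vs" "v = vs ! Suc i" using verts[of v] by (metis not0_implies_Suc)
    then have "vs ! Suc i \<in> nbrs G (vs ! i)" using succ by (simp add: successively_conv_nth)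
    then show "vs ! (idx v - 1) \<in> nbrs G v \<and> idx (vs ! (idx v - 1)) < idx v"
      using i by (simp add: idx nbrs_sym[of "vs ! i"])
  qed
  moreover have "card (nbrs T v) = (if v = hd vs \<or> v = last vs then 1 else 2)" if v: "v \<in> verts G" for v
  proof -
    obtain i where i: "i < length vs" "v = vs ! i" using verts[OF v] by blast
    \<comment> \<open>The children of \<open>vs ! i\<close>: at most its successor on the
      path.\<close>
    have "{w \<in> verts G - {vs ! 0}. vs ! (idx w - 1) = v} = (if Suc i < length vs then {vs ! Suc i} else {})"
      (is "?W = _")
    proof -
      have "w = vs ! Suc i \<and> Suc i < length vs" if w: "w \<in> ?W" for w
      proof -
        obtain j where "j < length vs" "w = vs ! j" using w verts by blast
        moreover from this obtain l where "j = Suc l" using w by (cases j) auto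
        ultimately show ?thesis using w i idx eq[of l i] by simp
      qed
      moreover have "vs ! Suc i \<in> ?W" if "Suc i < length vs"
        using that i eq[of "Suc i" 0] nth_mem[OF that] unfolding vs(2) by (simp add: idx) (metis length_greater_0_conv list.size(3) not_less0)
      ultimately show ?thesis by auto
    qed
    moreover have "v \<in> verts G - {vs ! 0} \<longleftrightarrow> i > 0" using v i eq[of i 0] ne by simp
    ultimately have nbrs: "nbrs T v = (if Suc i < length vs then {vs ! Suc i} else {})
        \<union> (if i > 0 then {vs ! (i - 1)} else {})"
      unfolding T_def nbrs_parent_tree using i by (simp add: idx)
    have "v = hd vs \<longleftrightarrow> i = 0" "v = last vs \<longleftrightarrow> i = length vs - 1"
      using i eq[of i 0] eq[of i "length vs - 1"] ne by (auto simp: hd_conv_nth last_conv_nth)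
    moreover have "vs ! Suc i \<noteq> vs ! (i - 1)" if "Suc i < length vs"
      using eq[of "Suc i" "i - 1"] that by simp
    moreover have "Suc i < length vs \<longleftrightarrow> i \<noteq> length vs - 1" using i(1) by auto
    ultimately show ?thesis
      using i(1) vs(3) unfolding nbrs by auto
  qed
  ultimately show thesis using that by blast
qed

section \<open>The 9-vertex fragment and the graph made of two copies\<close>

lemma two_of_three:
  assumes "card N = 2" "N \<subseteq> {x, y, z}" "distinct [x, y, z]"
  shows "(x \<in> N \<and> y \<in> N \<and> z \<notin> N) \<or> (x \<in> N \<and> y \<notin> N \<and> z \<in> N) \<or> (x \<notin> N \<and> y \<in> N \<and> z \<in> N)"
  using assms by (auto simp: card_2_iff)

lemma two_of_two:
  assumes "card N = 2" "N \<subseteq> {x, y}"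
  shows "x \<in> N \<and> y \<in> N"
  using assms by (auto simp: card_2_iff)

lemma two_of_four:
  assumes "card N = 2" "N \<subseteq> {w, x, y, z}" "distinct [w, x, y, z]"
  shows "(w \<in> N \<and> x \<in> N \<and> y \<notin> N \<and> z \<notin> N) \<or> (w \<in> N \<and> x \<notin> N \<and> y \<in> N \<and> z \<notin> N)
    \<or> (w \<in> N \<and> x \<notin> N \<and> y \<notin> N \<and> z \<in> N) \<or> (w \<notin> N \<and> x \<in> N \<and> y \<in> N \<and> z \<notin> N)
    \<or> (w \<notin> N \<and> x \<in> N \<and> y \<notin> N \<and> z \<in> N) \<or> (w \<notin> N \<and> x \<notin> N \<and> y \<in> N \<and> z \<in> N)"
  using assms by (auto simp: card_2_iff)

text \<open>The degree conditions leave finitely many possibilities for the edges of the cycle at the fragment, and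
  each of them makes some proper set of vertices closed under taking neighbours.\<close>

lemma fragment_not_in_cycle:
  assumes C: "cycle_graph C"
    and dist: "distinct [a0, a1, a2, a3, a4, a5, a6, a7, a8, p, q]"
    and sub: "{a0, a1, a2, a3, a4, a5, a6, a7, a8} \<subseteq> verts C"
    and proper: "\<not> verts C \<subseteq> {a0, a1, a2, a3, a4, a5, a6, a7, a8}"
    and N: "nbrs C a0 \<subseteq> {a3, a5, a7}" "nbrs C a1 \<subseteq> {a2, a5, a6}" "nbrs C a2 \<subseteq> {a1, a4, a7}"
      "nbrs C a3 \<subseteq> {a0, a4, a6}" "nbrs C a4 \<subseteq> {a2, a3, a5, a8}" "nbrs C a5 \<subseteq> {a0, a1, a4, a8}"
      "nbrs C a6 \<subseteq> {a1, a3, p}" "nbrs C a7 \<subseteq> {a0, a2, q}" "nbrs C a8 \<subseteq> {a4, a5}"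
  shows False
proof -
  have card: "card (nbrs C x) = 2" if "x \<in> {a0, a1, a2, a3, a4, a5, a6, a7, a8}" for x
    using cycle_graph_card_nbrs[OF C] sub that by blast
  have closed: "\<exists>y\<in>U. \<not> nbrs C y \<subseteq> U" if "U \<subseteq> {a0, a1, a2, a3, a4, a5, a6, a7, a8}" "U \<noteq> {}" for U
    using cycle_graph_closed[OF C, of _ U] that sub proper by blast
  have sym: "a2 \<in> nbrs C a1 \<longleftrightarrow> a1 \<in> nbrs C a2" "a3 \<in> nbrs C a0 \<longleftrightarrow> a0 \<in> nbrs C a3"
    "a4 \<in> nbrs C a2 \<longleftrightarrow> a2 \<in> nbrs C a4" "a4 \<in> nbrs C a3 \<longleftrightarrow> a3 \<in> nbrs C a4"
    "a5 \<in> nbrs C a0 \<longleftrightarrow> a0 \<in> nbrs C a5" "a5 \<in> nbrs C a1 \<longleftrightarrow> a1 \<in> nbrs C a5"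
    "a5 \<in> nbrs C a4 \<longleftrightarrow> a4 \<in> nbrs C a5" "a6 \<in> nbrs C a1 \<longleftrightarrow> a1 \<in> nbrs C a6"
    "a6 \<in> nbrs C a3 \<longleftrightarrow> a3 \<in> nbrs C a6" "a7 \<in> nbrs C a0 \<longleftrightarrow> a0 \<in> nbrs C a7"
    "a7 \<in> nbrs C a2 \<longleftrightarrow> a2 \<in> nbrs C a7" "a8 \<in> nbrs C a4 \<longleftrightarrow> a4 \<in> nbrs C a8"
    "a8 \<in> nbrs C a5 \<longleftrightarrow> a5 \<in> nbrs C a8"
    by (rule nbrs_sym)+
  \<comment> \<open>The cycle leaves the whole fragment, the triangle \<open>a4 a5 a8\<close>, and
    the two pentagons \<open>a1 a2 a4 a8 a5\<close> and \<open>a0 a3 a4 a8 a5\<close>. These are the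
    closed configurations that the degree conditions alone would permit.\<close>
  have "p \<in> nbrs C a6 \<or> q \<in> nbrs C a7"
    using closed[of "{a0, a1, a2, a3, a4, a5, a6, a7, a8}"] N by auto
  moreover have "a2 \<in> nbrs C a4 \<or> a3 \<in> nbrs C a4 \<or> a0 \<in> nbrs C a5 \<or> a1 \<in> nbrs C a5"
    using closed[of "{a4, a5, a8}"] N(5,6,9) by auto
  moreover have "a6 \<in> nbrs C a1 \<or> a7 \<in> nbrs C a2 \<or> a3 \<in> nbrs C a4 \<or> a5 \<in> nbrs C a4 \<or> a0 \<in> nbrs C a5"
    using closed[of "{a1, a2, a4, a5, a8}"] N(2,3,5,6,9) by auto
  moreover have "a7 \<in> nbrs C a0 \<or> a6 \<in> nbrs C a3 \<or> a2 \<in> nbrs C a4 \<or> a5 \<in> nbrs C a4 \<or> a1 \<in> nbrs C a5"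
    using closed[of "{a0, a3, a4, a5, a8}"] N(1,4,5,6,9) by auto
  \<comment> \<open>Each degree condition becomes a propositional statement about which of the
    possible edges are present, so a purely propositional contradiction is left.\<close>
  moreover note two_of_three[OF card N(1)] two_of_three[OF card N(2)] two_of_three[OF card N(3)]
    two_of_three[OF card N(4)] two_of_four[OF card N(5)] two_of_four[OF card N(6)]
    two_of_three[OF card N(7)] two_of_three[OF card N(8)] two_of_two[OF card N(9)]
  ultimately show False
    using dist unfolding sym by simp argo
qed

text \<open>Vertices 0 to 8 are one fragment and adding 9 gives the other; the last two pairs are
  the links 6-15 and 7-16. A list keeps the adjacency test executable.\<close>

definition two_fragments_edges :: "(nat \<times> nat) list" where
  "two_fragments_edges =
    [(1, 2), (0, 3), (2, 4), (3, 4), (0, 5), (1, 5), (4, 5), (1, 6), (3, 6), (0, 7), (2, 7), (4, 8), (5, 8),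
     (10, 11), (9, 12), (11, 13), (12, 13), (9, 14), (10, 14), (13, 14), (10, 15), (12, 15), (9, 16),
     (11, 16), (13, 17), (14, 17), (6, 15), (7, 16)]"

definition two_fragments :: "nat ugraph" where
  "two_fragments = UGraph {..<18} ((\<lambda>(i, j). {i, j}) ` set two_fragments_edges)"

lemma nbrs_two_fragments:
  "nbrs two_fragments v = {w. (v, w) \<in> set two_fragments_edges \<or> (w, v) \<in> set two_fragments_edges}"
  by (auto simp: nbrs_def two_fragments_def doubleton_eq_iff)

text \<open>Row \<open>v\<close> is a spanning path of the graph minus \<open>v\<close>; as 18 is not a vertex, row 18 belongs to the whole
  graph. All rows but 8 and 17 have ends 8 and 17.\<close>

definition spanning_paths :: "nat list list" where
  "spanning_paths =
   [[8, 5, 1, 6, 3, 4, 2, 7, 16, 9, 12, 15, 10, 11, 13, 14, 17],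
    [8, 5, 0, 7, 2, 4, 3, 6, 15, 10, 11, 16, 9, 12, 13, 14, 17],
    [8, 4, 3, 6, 1, 5, 0, 7, 16, 9, 12, 15, 10, 11, 13, 14, 17],
    [8, 4, 2, 7, 0, 5, 1, 6, 15, 10, 11, 16, 9, 12, 13, 14, 17],
    [8, 5, 0, 3, 6, 1, 2, 7, 16, 9, 12, 15, 10, 11, 13, 14, 17],
    [8, 4, 2, 1, 6, 3, 0, 7, 16, 9, 12, 15, 10, 11, 13, 14, 17],
    [8, 4, 3, 0, 5, 1, 2, 7, 16, 9, 12, 15, 10, 11, 13, 14, 17],
    [8, 4, 2, 1, 5, 0, 3, 6, 15, 10, 11, 16, 9, 12, 13, 14, 17],
    [4, 5, 0, 3, 6, 1, 2, 7, 16, 9, 12, 15, 10, 11, 13, 14, 17],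
    [8, 4, 5, 0, 3, 6, 1, 2, 7, 16, 11, 10, 15, 12, 13, 14, 17],
    [8, 4, 5, 1, 2, 7, 0, 3, 6, 15, 12, 9, 16, 11, 13, 14, 17],
    [8, 4, 5, 0, 3, 6, 1, 2, 7, 16, 9, 12, 15, 10, 14, 13, 17],
    [8, 4, 5, 1, 2, 7, 0, 3, 6, 15, 10, 11, 16, 9, 14, 13, 17],
    [8, 4, 5, 0, 3, 6, 1, 2, 7, 16, 11, 10, 15, 12, 9, 14, 17],
    [8, 4, 5, 0, 3, 6, 1, 2, 7, 16, 9, 12, 15, 10, 11, 13, 17],
    [8, 4, 5, 0, 3, 6, 1, 2, 7, 16, 9, 12, 13, 11, 10, 14, 17],
    [8, 4, 5, 1, 2, 7, 0, 3, 6, 15, 10, 11, 13, 12, 9, 14, 17],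
    [8, 4, 5, 0, 3, 6, 1, 2, 7, 16, 11, 10, 15, 12, 9, 14, 13],
    [8, 4, 5, 0, 3, 6, 1, 2, 7, 16, 9, 12, 15, 10, 11, 13, 14, 17]]"

text \<open>The last conjunct bounds the transition cost: degrees in two spanning paths differ
  exactly at the common vertices that are an end of only one of them, and the reference path ends in
  8 and 17.\<close>

definition is_spanning_path :: "nat \<Rightarrow> nat list \<Rightarrow> bool" where
  "is_spanning_path v vs \<longleftrightarrow> distinct vs \<and> length vs \<ge> 2 \<and> set vs = set (filter (\<lambda>x. x \<noteq> v) [0..<18])
     \<and> successively (\<lambda>x y. (x, y) \<in> set two_fragments_edges \<or> (y, x) \<in> set two_fragments_edges) vs
     \<and> length (filter (\<lambda>x. (x = hd vs \<or> x = last vs) \<noteq> (x = 8 \<or> x = 17)) vs) \<le> 1"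

lemma list_all_spanning_paths: "list_all (\<lambda>v. is_spanning_path v (spanning_paths ! v)) [0..<19]"
  by code_simp

lemma spanning_paths:
  assumes "v \<le> 18"
  shows "distinct (spanning_paths ! v)" "length (spanning_paths ! v) \<ge> 2"
    "set (spanning_paths ! v) = {..<18} - {v}"
    "successively (\<lambda>x y. y \<in> nbrs two_fragments x) (spanning_paths ! v)"
    "length (filter (\<lambda>x. (x = hd (spanning_paths ! v) \<or> x = last (spanning_paths ! v)) \<noteq> (x = 8 \<or> x = 17))
       (spanning_paths ! v)) \<le> 1"
proof -
  have "v \<in> set [0..<19]" using assms by simp
  then have "is_spanning_path v (spanning_paths ! v)"
    using list_all_spanning_paths unfolding list_all_iff by blast
  note path = this[unfolded is_spanning_path_def]
  have "set (filter (\<lambda>x. x \<noteq> v) [0..<18]) = {..<18} - {v}" by auto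
  with path show "distinct (spanning_paths ! v)" "length (spanning_paths ! v) \<ge> 2"
    "set (spanning_paths ! v) = {..<18} - {v}"
    "successively (\<lambda>x y. y \<in> nbrs two_fragments x) (spanning_paths ! v)"
    "length (filter (\<lambda>x. (x = hd (spanning_paths ! v) \<or> x = last (spanning_paths ! v)) \<noteq> (x = 8 \<or> x = 17))
       (spanning_paths ! v)) \<le> 1"
    unfolding nbrs_two_fragments mem_Collect_eq by argo+
qed

lemma verts_two_fragments [simp]: "verts two_fragments = {..<18}"
  by (simp add: two_fragments_def)

lemma nbrs_two_fragments_subset:
  "nbrs two_fragments 0 \<subseteq> {3, 5, 7}" "nbrs two_fragments 1 \<subseteq> {2, 5, 6}"
  "nbrs two_fragments 2 \<subseteq> {1, 4, 7}" "nbrs two_fragments 3 \<subseteq> {0, 4, 6}"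
  "nbrs two_fragments 4 \<subseteq> {2, 3, 5, 8}" "nbrs two_fragments 5 \<subseteq> {0, 1, 4, 8}"
  "nbrs two_fragments 6 \<subseteq> {1, 3, 15}" "nbrs two_fragments 7 \<subseteq> {0, 2, 16}"
  "nbrs two_fragments 8 \<subseteq> {4, 5}"
  "nbrs two_fragments 9 \<subseteq> {12, 14, 16}" "nbrs two_fragments 10 \<subseteq> {11, 14, 15}"
  "nbrs two_fragments 11 \<subseteq> {10, 13, 16}" "nbrs two_fragments 12 \<subseteq> {9, 13, 15}"
  "nbrs two_fragments 13 \<subseteq> {11, 12, 14, 17}" "nbrs two_fragments 14 \<subseteq> {9, 10, 13, 17}"
  "nbrs two_fragments 15 \<subseteq> {10, 12, 6}" "nbrs two_fragments 16 \<subseteq> {9, 11, 7}"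
  "nbrs two_fragments 17 \<subseteq> {13, 14}"
  unfolding nbrs_two_fragments two_fragments_edges_def by simp_all blast+

lemma simple_two_fragments: "simple_graph two_fragments"
proof -
  have "\<forall>(i, j)\<in>set two_fragments_edges. i < 18 \<and> j < 18 \<and> i \<noteq> j"
    by (simp add: two_fragments_edges_def)
  then show ?thesis by (auto simp: simple_graph_def two_fragments_def)
qed

text \<open>Makes the whole graph the case \<open>v = 18\<close> of the statements about
  deletions.\<close>

lemma delete_none_two_fragments: "delete_verts two_fragments {18} = two_fragments"
  by (rule delete_verts_disjoint[OF simple_two_fragments]) simp

lemma not_hamiltonian_two_fragments: "\<not> hamiltonian (delete_verts two_fragments {v})"
proof
  assume "hamiltonian (delete_verts two_fragments {v})"
  then obtain C where C: "cycle_graph C" "verts C = {..<18} - {v}"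
    and N: "\<And>w. nbrs C w \<subseteq> nbrs (delete_verts two_fragments {v}) w"
    by (rule hamiltonianE) auto
  have N': "nbrs C w \<subseteq> nbrs two_fragments w" for w
    using N[of w] by (auto simp: nbrs_delete_verts split: if_splits)
  show False
  proof (cases "v < 9")
    case True
    \<comment> \<open>A surviving vertex of the damaged copy, showing that the cycle is not confined
      to the intact one.\<close>
    have "(if v = 0 then 1 else 0) \<in> verts C" using C(2) by simp
    show False
    proof (rule fragment_not_in_cycle[OF C(1), of 9 10 11 12 13 14 15 16 17 6 7])
      show "\<not> verts C \<subseteq> {9, 10, 11, 12, 13, 14, 15, 16, 17}"
        using \<open>_ \<in> verts C\<close> by (auto split: if_splits)
    qed (rule N'[THEN subset_trans] nbrs_two_fragments_subset | use True in \<open>simp add: C(2)\<close>)+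
  next
    case False
    have "(if v = 9 then 10 else 9) \<in> verts C" using C(2) by simp
    show False
    proof (rule fragment_not_in_cycle[OF C(1), of 0 1 2 3 4 5 6 7 8 15 16])
      show "\<not> verts C \<subseteq> {0, 1, 2, 3, 4, 5, 6, 7, 8}"
        using \<open>_ \<in> verts C\<close> by (auto split: if_splits)
    qed (rule N'[THEN subset_trans] nbrs_two_fragments_subset | use False in \<open>simp add: C(2)\<close>)+
  qed
qed

lemma card_two_fragments: "2 < card ({..<18 :: nat} - {v})"
  using card_Diff1_le[of "{..<18}" v] by (simp add: card_Diff_singleton_if)

text \<open>The tabulated path has only two leaves, and no tree on these vertices has fewer, so the
  optimal trees are exactly the spanning paths.\<close>

lemma ml_subgraphs_two_fragments:
  assumes "v \<le> 18"
  obtains T where "T \<in> ml_subgraphs (delete_verts two_fragments {v})" "simple_graph T"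
    "spanning_tree T (delete_verts two_fragments {v})"
    "\<forall>x\<in>{..<18} - {v}. card (nbrs T x) = (if x = hd (spanning_paths ! v) \<or> x = last (spanning_paths ! v) then 1 else 2)"
    "ml_subgraphs (delete_verts two_fragments {v}) =
       {T. spanning_tree T (delete_verts two_fragments {v}) \<and> card (leaves T) = 2}"
proof -
  let ?G = "delete_verts two_fragments {v}" and ?vs = "spanning_paths ! v"
  have vs: "distinct ?vs" "length ?vs \<ge> 2" "set ?vs = verts ?G"
    using spanning_paths(1-3)[OF assms] by simp_all
  have succ: "successively (\<lambda>x y. y \<in> nbrs ?G x) ?vs"
    using spanning_paths(4)[OF assms]
    by (rule successively_mono) (use vs(3) in \<open>auto simp: nbrs_delete_verts\<close>)
  obtain T where T: "spanning_tree T ?G"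
    and card: "\<forall>x\<in>verts ?G. card (nbrs T x) = (if x = hd ?vs \<or> x = last ?vs then 1 else 2)"
    by (rule spanning_path[OF simple_graph_delete_verts[OF simple_two_fragments] vs(1,3,2) succ])
  have "leaves T \<subseteq> {hd ?vs, last ?vs}"
  proof
    fix x assume "x \<in> leaves T"
    then have x: "x \<in> verts ?G" "card (nbrs T x) = 1"
      using spanning_treeD(2,4)[OF T] by (simp_all add: mem_leaves)
    show "x \<in> {hd ?vs, last ?vs}"
    proof (rule ccontr)
      assume "x \<notin> {hd ?vs, last ?vs}"
      then have "card (nbrs T x) = 2" using bspec[OF card x(1)] by simp
      with x(2) show False by simp
    qed
  qed
  then have "card (leaves T) \<le> card {hd ?vs, last ?vs}" by (intro card_mono) auto
  also have "\<dots> \<le> 2" by (simp add: card_insert_if)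
  finally have le: "card (leaves T) \<le> 2" .
  have ge: "2 \<le> card (leaves T)" if "spanning_tree T ?G" for T
    using tree_two_leaves[of T] spanning_treeD(1,4)[OF that] card_two_fragments[of v] by simp
  have ml: "ml_subgraphs ?G = {T. spanning_tree T ?G \<and> card (leaves T) = 2}"
    by (rule ml_subgraphs_eq[OF not_hamiltonian_two_fragments T le ge])
  show thesis
    by (rule that[of T]) (use T card ml le ge[OF T] spanning_treeD(2)[OF T] in auto)
qed

lemma fault_cost_two_fragments: "fault_cost two_fragments = enat 1"
proof -
  let ?G = two_fragments
  have ends: "hd (spanning_paths ! 18) = 8" "last (spanning_paths ! 18) = 17"
    by (simp_all add: spanning_paths_def)
  obtain S where S: "S \<in> ml_subgraphs ?G" "simple_graph S"
    and S_deg: "\<forall>x\<in>{..<18} - {18}. card (nbrs S x) = (if x = 8 \<or> x = 17 then 1 else 2)"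
    and ml: "ml_subgraphs ?G = {T. spanning_tree T ?G \<and> card (leaves T) = 2}"
    by (rule ml_subgraphs_two_fragments[OF order_refl, unfolded delete_none_two_fragments ends])
  show ?thesis
  proof (rule fault_cost_eqI[OF S(1)])
    fix v assume "v \<in> verts ?G"
    then have v: "v < 18" by simp
    let ?vs = "spanning_paths ! v"
    obtain T where T: "T \<in> ml_subgraphs (delete_verts ?G {v})" "simple_graph T"
      "spanning_tree T (delete_verts ?G {v})"
      "\<forall>x\<in>{..<18} - {v}. card (nbrs T x) = (if x = hd ?vs \<or> x = last ?vs then 1 else 2)"
      by (rule ml_subgraphs_two_fragments[OF less_imp_le[OF v]])
    let ?D = "filter (\<lambda>x. (x = hd ?vs \<or> x = last ?vs) \<noteq> (x = 8 \<or> x = 17)) ?vs"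
    have vs: "set ?vs = {..<18} - {v}" "length ?D \<le> 1"
      using spanning_paths(3,5)[of v] v by auto
    have "{w \<in> verts ?G - {v}. card (nbrs S w) \<noteq> card (nbrs T w)} \<subseteq> set ?D"
    proof
      fix w assume w: "w \<in> {w \<in> verts ?G - {v}. card (nbrs S w) \<noteq> card (nbrs T w)}"
      then have wS: "w \<in> {..<18} - {18}" and wT: "w \<in> {..<18} - {v}" by auto
      have "(w = hd ?vs \<or> w = last ?vs) \<noteq> (w = 8 \<or> w = 17)"
      proof
        assume "(w = hd ?vs \<or> w = last ?vs) = (w = 8 \<or> w = 17)"
        then have "card (nbrs S w) = card (nbrs T w)"
          unfolding bspec[OF S_deg wS] bspec[OF T(4) wT] by simp
        with w show False by simp
      qed
      with wT vs(1) show "w \<in> set ?D" by simp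
    qed
    then have "transition_cost ?G v S T \<le> card (set ?D)"
      unfolding transition_cost_nbrs[OF S(2) T(2)] by (intro card_mono) auto
    also have "\<dots> \<le> 1" using card_length[of ?D] vs(2) by linarith
    finally show "\<exists>S'\<in>ml_subgraphs (delete_verts ?G {v}). transition_cost ?G v S S' \<le> 1"
      using T(1) by blast
  next
    fix S assume "S \<in> ml_subgraphs ?G"
    then have S: "spanning_tree S ?G" "card (leaves S) = 2" using ml by auto
    obtain x y where xy: "leaves S = {x, y}" using S(2) by (auto simp: card_2_iff)
    then have x: "x < 18" using spanning_treeD(4)[OF S(1)] by (auto simp: leaves_def)
    \<comment> \<open>When the end \<open>x\<close> of \<open>S\<close> fails, the new path still
      has two ends, and \<open>S\<close> has only \<open>y\<close> left to offer. The other end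
      \<open>z\<close> was not a leaf of \<open>S\<close>.\<close>
    have "1 \<le> transition_cost ?G x S S'" if S': "S' \<in> ml_subgraphs (delete_verts ?G {x})" for S'
    proof -
      have "ml_subgraphs (delete_verts ?G {x}) =
          {T. spanning_tree T (delete_verts ?G {x}) \<and> card (leaves T) = 2}"
        by (rule ml_subgraphs_two_fragments[OF less_imp_le[OF x]])
      with S' have T: "spanning_tree S' (delete_verts ?G {x})" "card (leaves S') = 2" by auto
      have "\<not> leaves S' \<subseteq> {y}" using T(2) card_mono[of "{y}" "leaves S'"] by auto
      then obtain z where z: "z \<in> leaves S'" "z \<noteq> y" by blast
      moreover have "leaves S' \<subseteq> {..<18} - {x}" using spanning_treeD(4)[OF T(1)] by (auto simp: leaves_def)
      ultimately have "z \<in> {..<18} - {x}" "deg S' z = 1" by (auto simp: leaves_def)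
      moreover have "deg S z \<noteq> 1"
        using z(2) xy \<open>z \<in> {..<18} - {x}\<close> spanning_treeD(4)[OF S(1)] by (auto simp: leaves_def)
      ultimately have "{w \<in> verts ?G - {x}. deg S w \<noteq> deg S' w} \<noteq> {}" by auto
      then show ?thesis by (simp add: transition_cost_def Suc_le_eq card_gt_0_iff)
    qed
    then show "\<exists>v\<in>verts ?G. \<forall>S'\<in>ml_subgraphs (delete_verts ?G {v}). 1 \<le> transition_cost ?G v S S'"
      using x by (intro bexI[of _ x]) auto
  qed
qed

text \<open>The tabulated spanning paths already show that the graph and all its vertex-deleted
  subgraphs are connected.\<close>

lemma k_connected_two_fragments: "k_connected 2 two_fragments"
proof (rule two_connectedI)
  show "connected_graph two_fragments"
    by (rule ml_subgraphs_two_fragments[OF order_refl, unfolded delete_none_two_fragments])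
      (rule spanning_tree_connected)
next
  fix v assume "v \<in> verts two_fragments"
  then have "v \<le> 18" by simp
  then show "connected_graph (delete_verts two_fragments {v})"
    by (rule ml_subgraphs_two_fragments) (rule spanning_tree_connected)
qed (simp_all add: simple_two_fragments)

section \<open>Fault costs at least 3: windmills\<close>

datatype vertex = Top | Hub | Tip nat bool | Arm nat bool

instance vertex :: countable
  by countable_datatype

text \<open>The guards isolate all vertices of index at least \<open>n\<close>, which makes this
  neighbourhood function symmetric on the whole type.\<close>

fun adj :: "nat \<Rightarrow> vertex \<Rightarrow> vertex set" where
  "adj n Top = {Tip i s | i s. i < n}"
| "adj n Hub = {Arm i s | i s. i < n}"
| "adj n (Tip i s) = (if i < n then {Top, Arm i s} else {})"
| "adj n (Arm i s) = (if i < n then {Tip i s, Hub, Arm i (\<not> s)} else {})"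

definition windmill :: "nat \<Rightarrow> vertex ugraph" where
  "windmill n = UGraph (insert Top (insert Hub (case_prod Tip ` ({..<n} \<times> UNIV) \<union> case_prod Arm ` ({..<n} \<times> UNIV))))
     {{x, y} | x y. y \<in> adj n x}"

lemma adj_sym: "y \<in> adj n x \<longleftrightarrow> x \<in> adj n y"
  by (cases x; cases y) auto

lemma nbrs_windmill [simp]: "nbrs (windmill n) = adj n"
proof
  fix x show "nbrs (windmill n) x = adj n x"
    using adj_sym by (auto simp: nbrs_def windmill_def doubleton_eq_iff)
qed

lemma mem_verts_windmill [simp]:
  "Top \<in> verts (windmill n)" "Hub \<in> verts (windmill n)"
  "Tip i s \<in> verts (windmill n) \<longleftrightarrow> i < n" "Arm i s \<in> verts (windmill n) \<longleftrightarrow> i < n"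
  by (auto simp: windmill_def)

lemma simple_windmill: "simple_graph (windmill n)"
proof -
  have "x \<in> verts (windmill n) \<and> y \<in> verts (windmill n) \<and> x \<noteq> y" if "y \<in> adj n x" for x y
    using that by (cases x; cases y) (auto split: if_splits)
  moreover have "finite (verts (windmill n))" by (simp add: windmill_def)
  ultimately show ?thesis
    by (auto simp: simple_graph_def) (auto simp: windmill_def)
qed

lemma finite_windmill: "finite (verts (windmill n))"
  using simple_windmill by (simp add: simple_graph_def)

text \<open>With a set \<open>D\<close> the intact windmill is the case of the empty set and shares
  its lemmas with the deletions.\<close>

abbreviation windmill_minus :: "nat \<Rightarrow> vertex set \<Rightarrow> vertex ugraph" where
  "windmill_minus n D \<equiv> delete_verts (windmill n) D"

lemma windmill_minus_empty: "windmill_minus n {} = windmill n"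
  by (rule delete_verts_disjoint[OF simple_windmill]) simp

text \<open>A surviving tip has only two possible neighbours, so a hamiltonian cycle contains its
  edge to \<open>Top\<close>. At least three of the four tips of two blades survive, too many for
  the degree of \<open>Top\<close> in the cycle.\<close>

lemma not_hamiltonian_windmill_minus:
  assumes "n \<ge> 2" "D \<subseteq> {v}"
  shows "\<not> hamiltonian (windmill_minus n D)"
proof
  assume "hamiltonian (windmill_minus n D)"
  then obtain C where C: "simple_graph C" "verts C = verts (windmill n) - D"
    and N: "\<And>x. nbrs C x \<subseteq> nbrs (windmill_minus n D) x"
    and card: "\<And>x. x \<in> verts (windmill n) - D \<Longrightarrow> card (nbrs C x) = 2"
    by (rule hamiltonianE) auto
  have N': "nbrs C x \<subseteq> adj n x - D" for x
    using N[of x] by (auto simp: nbrs_delete_verts split: if_splits)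
  have tip: "nbrs C (Tip i s) = {Top, Arm i s} \<and> Top \<notin> D" if "Tip i s \<notin> D" "i < n" for i s
  proof -
    have "card (nbrs C (Tip i s)) = 2" using card that by simp
    moreover have "nbrs C (Tip i s) \<subseteq> {Top, Arm i s} - D" using N'[of "Tip i s"] that by auto
    ultimately show ?thesis by (auto simp: card_2_iff)
  qed
  let ?M = "{Tip 0 True, Tip 0 False, Tip 1 True, Tip 1 False}"
  have sub: "?M - D \<subseteq> nbrs C Top"
    using tip assms(1) by (auto simp: nbrs_sym[of _ C Top])
  have "?M - {v} \<subseteq> ?M - D" using assms(2) by blast
  then have "card (?M - {v}) \<le> card (nbrs C Top)"
    using sub finite_nbrs[OF C(1)] by (meson card_mono order_trans)
  moreover have "card (?M - {v}) \<ge> 3"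
    using card_Diff1_le[of ?M v] by (simp add: card_Diff_singleton_if)
  moreover have "card (nbrs C Top) \<le> 2"
  proof (cases "Top \<in> D")
    case True
    then show ?thesis using N[of Top] by (simp add: nbrs_delete_verts)
  qed (use card[of Top] in simp)
  ultimately show False by linarith
qed

section \<open>Spanning trees of the windmill\<close>

text \<open>From the top, the tree enters blade \<open>i\<close> on side \<open>d i\<close>. The hub hangs off blade \<open>c\<close>, and \<open>C\<close> is the set of
  blades whose other arm hangs off the hub instead of the first arm.\<close>

fun parent :: "nat \<Rightarrow> nat set \<Rightarrow> (nat \<Rightarrow> bool) \<Rightarrow> vertex \<Rightarrow> vertex" where
  "parent c C d Top = Top"
| "parent c C d Hub = Arm c (d c)"
| "parent c C d (Tip i s) = (if s = d i then Top else Arm i s)"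
| "parent c C d (Arm i s) = (if s = d i then Tip i s else if i \<in> C then Hub else Arm i (\<not> s))"

text \<open>Not the distance from \<open>Top\<close>, but one ranking that works for all
  \<open>c\<close>, \<open>C\<close> and \<open>d\<close>: \<open>Hub\<close> lies above the first
  arms, which may be its parent, and below the second arms, which may be its children.\<close>

fun depth :: "(nat \<Rightarrow> bool) \<Rightarrow> vertex \<Rightarrow> nat" where
  "depth d Top = 0"
| "depth d Hub = 3"
| "depth d (Tip i s) = (if s = d i then 1 else 5)"
| "depth d (Arm i s) = (if s = d i then 2 else 4)"

definition windmill_tree :: "nat \<Rightarrow> vertex set \<Rightarrow> nat \<Rightarrow> nat set \<Rightarrow> (nat \<Rightarrow> bool) \<Rightarrow> vertex ugraph" where
  "windmill_tree n D c C d = parent_tree (verts (windmill_minus n D)) Top (parent c C d)"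

text \<open>A parent tree survives the loss of vertices without surviving children. For each
  deletion, \<open>c\<close>, \<open>C\<close> and \<open>d\<close> are chosen to put the lost
  vertex in such a place.\<close>

lemma spanning_windmill_tree:
  assumes "c < n" "Top \<notin> D" "\<And>v. v \<in> verts (windmill n) \<Longrightarrow> v \<noteq> Top \<Longrightarrow> v \<notin> D \<Longrightarrow> parent c C d v \<notin> D"
  shows "spanning_tree (windmill_tree n D c C d) (windmill_minus n D)"
  unfolding windmill_tree_def
proof (rule spanning_parent_tree[OF simple_graph_delete_verts[OF simple_windmill], where rank = "depth d"])
  fix v assume v: "v \<in> verts (windmill_minus n D)" "v \<noteq> Top"
  then have "parent c C d v \<notin> D" using assms(3) by simp
  moreover have "parent c C d v \<in> adj n v" "depth d (parent c C d v) < depth d v"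
    using v assms(1) by (cases v; auto)+
  ultimately show "parent c C d v \<in> nbrs (windmill_minus n D) v \<and> depth d (parent c C d v) < depth d v"
    using v by (simp add: nbrs_delete_verts)
qed (use assms(2) in simp)

lemma nbrs_windmill_tree:
  assumes "c < n" "Top \<notin> D"
  shows "nbrs (windmill_tree n D c C d) Top = (\<lambda>i. Tip i (d i)) ` {..<n} - D"
    and "Hub \<notin> D \<Longrightarrow> nbrs (windmill_tree n D c C d) Hub =
      insert (Arm c (d c)) ((\<lambda>i. Arm i (\<not> d i)) ` (C \<inter> {..<n}) - D)"
    and "i < n \<Longrightarrow> Tip i s \<notin> D \<Longrightarrow> nbrs (windmill_tree n D c C d) (Tip i s) =
      (if s = d i then insert Top ({Arm i s} - D) else {Arm i s})"
    and "i < n \<Longrightarrow> Arm i s \<notin> D \<Longrightarrow> nbrs (windmill_tree n D c C d) (Arm i s) =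
      (if s = d i then insert (Tip i s) (((if i \<in> C then {} else {Arm i (\<not> s)}) \<union> (if i = c then {Hub} else {})) - D)
       else insert (if i \<in> C then Hub else Arm i (\<not> s)) ({Tip i s} - D))"
proof -
  let ?T = "windmill_tree n D c C d"
  have mem: "w \<in> nbrs ?T v \<longleftrightarrow> (w \<in> verts (windmill n) \<and> w \<notin> D \<and> w \<noteq> Top \<and> parent c C d w = v)
    \<or> (v \<in> verts (windmill n) \<and> v \<notin> D \<and> v \<noteq> Top \<and> w = parent c C d v)" for v w
    by (auto simp: windmill_tree_def nbrs_parent_tree)
  show "nbrs ?T Top = (\<lambda>i. Tip i (d i)) ` {..<n} - D"
  proof (rule set_eqI)
    fix w show "w \<in> nbrs ?T Top \<longleftrightarrow> w \<in> (\<lambda>i. Tip i (d i)) ` {..<n} - D"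
      unfolding mem by (cases w) auto
  qed
  show "nbrs ?T Hub = insert (Arm c (d c)) ((\<lambda>i. Arm i (\<not> d i)) ` (C \<inter> {..<n}) - D)" if "Hub \<notin> D"
  proof (rule set_eqI)
    fix w show "w \<in> nbrs ?T Hub \<longleftrightarrow> w \<in> insert (Arm c (d c)) ((\<lambda>i. Arm i (\<not> d i)) ` (C \<inter> {..<n}) - D)"
      unfolding mem using that by (cases w) auto
  qed
  show "nbrs ?T (Tip i s) = (if s = d i then insert Top ({Arm i s} - D) else {Arm i s})"
    if "i < n" "Tip i s \<notin> D"
  proof (rule set_eqI)
    fix w show "w \<in> nbrs ?T (Tip i s) \<longleftrightarrow> w \<in> (if s = d i then insert Top ({Arm i s} - D) else {Arm i s})"
      unfolding mem using that by (cases w) auto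
  qed
  show "nbrs ?T (Arm i s) =
      (if s = d i then insert (Tip i s) (((if i \<in> C then {} else {Arm i (\<not> s)}) \<union> (if i = c then {Hub} else {})) - D)
       else insert (if i \<in> C then Hub else Arm i (\<not> s)) ({Tip i s} - D))" (is "_ = ?R")
    if "i < n" "Arm i s \<notin> D"
  proof (rule set_eqI)
    fix w show "w \<in> nbrs ?T (Arm i s) \<longleftrightarrow> w \<in> ?R"
      unfolding mem using that assms by (cases w) auto
  qed
qed

text \<open>The spider centred at \<open>Hub\<close> with \<open>2 * n\<close> legs of length
  2.\<close>

definition top_tree :: "nat \<Rightarrow> vertex ugraph" where
  "top_tree n = parent_tree (verts (windmill_minus n {Top})) Hub
     (\<lambda>v. case v of Tip i s \<Rightarrow> Arm i s | _ \<Rightarrow> Hub)"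

lemma spanning_top_tree: "spanning_tree (top_tree n) (windmill_minus n {Top})"
  unfolding top_tree_def
proof (rule spanning_parent_tree[OF simple_graph_delete_verts[OF simple_windmill],
      where rank = "\<lambda>v. case v of Tip i s \<Rightarrow> 2 | Arm i s \<Rightarrow> 1 | _ \<Rightarrow> 0"])
  fix v assume "v \<in> verts (windmill_minus n {Top})" "v \<noteq> Hub"
  then show "(case v of Tip i s \<Rightarrow> Arm i s | _ \<Rightarrow> Hub) \<in> nbrs (windmill_minus n {Top}) v \<and>
    (case case v of Tip i s \<Rightarrow> Arm i s | _ \<Rightarrow> Hub of Tip i s \<Rightarrow> 2 | Arm i s \<Rightarrow> 1 | _ \<Rightarrow> 0)
      < (case v of Tip i s \<Rightarrow> 2 | Arm i s \<Rightarrow> 1 | _ \<Rightarrow> (0 :: nat))"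
    by (cases v) (auto simp: nbrs_delete_verts)
qed simp

lemma nbrs_top_tree_Arm:
  assumes "i < n"
  shows "nbrs (top_tree n) (Arm i s) = {Hub, Tip i s}"
proof (rule set_eqI)
  fix w show "w \<in> nbrs (top_tree n) (Arm i s) \<longleftrightarrow> w \<in> {Hub, Tip i s}"
    using assms by (cases w) (auto simp: top_tree_def nbrs_parent_tree)
qed

lemma nbrs_top_tree_Hub: "nbrs (top_tree n) Hub = case_prod Arm ` ({..<n} \<times> UNIV)"
proof (rule set_eqI)
  fix w show "w \<in> nbrs (top_tree n) Hub \<longleftrightarrow> w \<in> case_prod Arm ` ({..<n} \<times> UNIV)"
    by (cases w) (auto simp: top_tree_def nbrs_parent_tree)
qed

lemma nbrs_top_tree_Tip:
  assumes "i < n"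
  shows "nbrs (top_tree n) (Tip i s) = {Arm i s}"
proof (rule set_eqI)
  fix w show "w \<in> nbrs (top_tree n) (Tip i s) \<longleftrightarrow> w \<in> {Arm i s}"
    using assms by (cases w) (auto simp: top_tree_def nbrs_parent_tree)
qed

section \<open>Leaves of an arbitrary spanning tree\<close>

definition blade :: "nat \<Rightarrow> vertex set" where
  "blade i = {Tip i True, Tip i False, Arm i True, Arm i False}"

lemma mem_blade: "x \<in> blade i \<longleftrightarrow> (\<exists>s. x = Tip i s \<or> x = Arm i s)"
  by (auto simp: blade_def)

lemma blade_unique: "x \<in> blade i \<Longrightarrow> x \<in> blade j \<Longrightarrow> i = j"
  by (auto simp: mem_blade)

locale windmill_spanning_tree =
  fixes n :: nat and D :: "vertex set" and T :: "vertex ugraph"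
  assumes spanning: "spanning_tree T (windmill_minus n D)"
begin

lemmas tree = spanning_treeD(1)[OF spanning]
lemmas simple = spanning_treeD(2)[OF spanning]
lemmas connected = spanning_treeD(3)[OF spanning]

lemma verts_T: "verts T = verts (windmill n) - D"
  using spanning_treeD(4)[OF spanning] by simp

lemma nbrs_T: "nbrs T x \<subseteq> adj n x - D"
  by (rule subset_trans[OF spanning_treeD(5)[OF spanning]]) (simp add: nbrs_delete_verts)

lemma nonleaf:
  assumes "x \<in> verts T" "y \<in> verts T" "x \<noteq> y" "x \<notin> leaves T"
  shows "card (nbrs T x) \<ge> 2"
  by (rule card_nbrs_nonleaf[OF tree assms(1,4)]) (use assms(2,3) in auto)

lemma nbrs_nonempty:
  assumes "x \<in> verts T" "y \<in> verts T" "x \<noteq> y"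
  shows "nbrs T x \<noteq> {}"
  by (rule connected_graph_nbrs_nonempty[OF connected assms(1)]) (use assms(2,3) in auto)

lemma nonleaf_two:
  assumes "card (nbrs T x) \<ge> 2" "nbrs T x \<subseteq> {a, b}"
  shows "nbrs T x = {a, b}"
proof (rule card_seteq)
  have "card {a, b} \<le> 2" by (simp add: card_insert_if)
  then show "card {a, b} \<le> card (nbrs T x)" using assms(1) by (rule order_trans)
qed (use assms(2) in auto)

lemma Tip_nonleaf:
  assumes "i < n" "Tip i s \<notin> D" "Top \<notin> D" "Tip i s \<notin> leaves T"
  shows "Top \<in> nbrs T (Tip i s)" "Arm i s \<in> nbrs T (Tip i s)"
proof -
  have "card (nbrs T (Tip i s)) \<ge> 2"
    by (rule nonleaf[of _ Top]) (use assms in \<open>auto simp: verts_T\<close>)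
  then have "nbrs T (Tip i s) = {Top, Arm i s}"
    by (rule nonleaf_two) (use nbrs_T[of "Tip i s"] assms(1) in auto)
  then show "Top \<in> nbrs T (Tip i s)" "Arm i s \<in> nbrs T (Tip i s)" by auto
qed

lemma Arm_nonleaf:
  assumes "i < n" "Arm i s \<notin> D" "Top \<notin> D" "Arm i s \<notin> leaves T"
  shows "Hub \<in> nbrs T (Arm i s) \<or> Arm i (\<not> s) \<in> nbrs T (Arm i s)"
proof (rule ccontr)
  assume "\<not> ?thesis"
  moreover have "nbrs T (Arm i s) \<subseteq> {Tip i s, Hub, Arm i (\<not> s)}"
    using nbrs_T[of "Arm i s"] assms(1) by auto
  ultimately have "nbrs T (Arm i s) \<subseteq> {Tip i s}" by blast
  then have "card (nbrs T (Arm i s)) \<le> card {Tip i s}" by (rule card_mono[rotated]) simp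
  then have "card (nbrs T (Arm i s)) \<le> 1" by simp
  moreover have "card (nbrs T (Arm i s)) \<ge> 2"
    by (rule nonleaf[of _ Top]) (use assms in \<open>auto simp: verts_T\<close>)
  ultimately show False by simp
qed

text \<open>The two kinds of route from \<open>Top\<close> to \<open>Hub\<close> within blade
  \<open>i\<close>: straight down one side, or down one side and across the edge between the
  arms.\<close>

definition linked :: "nat \<Rightarrow> bool" where
  "linked i \<longleftrightarrow> (\<exists>s. Top \<in> nbrs T (Tip i s) \<and> Arm i s \<in> nbrs T (Tip i s) \<and>
     (Hub \<in> nbrs T (Arm i s) \<or> Arm i (\<not> s) \<in> nbrs T (Arm i s) \<and> Hub \<in> nbrs T (Arm i (\<not> s))))"

text \<open>Routes through two different blades meet only in \<open>Top\<close> and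
  \<open>Hub\<close>, so together they form a cycle.\<close>

lemma not_linked_twice:
  assumes "linked i" "linked j" "i \<noteq> j"
  shows False
proof -
  have path: "\<exists>p. distinct p \<and> set p \<subseteq> blade i \<and> p \<noteq> [] \<and> successively (\<lambda>x y. y \<in> nbrs T x) (Top # p @ [Hub])"
    if "linked i" for i
  proof -
    from that obtain s where s: "Top \<in> nbrs T (Tip i s)" "Arm i s \<in> nbrs T (Tip i s)"
      "Hub \<in> nbrs T (Arm i s) \<or> Arm i (\<not> s) \<in> nbrs T (Arm i s) \<and> Hub \<in> nbrs T (Arm i (\<not> s))"
      by (auto simp: linked_def)
    from s(3) show ?thesis
    proof
      assume "Hub \<in> nbrs T (Arm i s)"
      with s(1,2) show ?thesis
        by (intro exI[of _ "[Tip i s, Arm i s]"]) (auto simp: mem_blade nbrs_sym[of _ T Top])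
    next
      assume "Arm i (\<not> s) \<in> nbrs T (Arm i s) \<and> Hub \<in> nbrs T (Arm i (\<not> s))"
      with s(1,2) show ?thesis
        by (intro exI[of _ "[Tip i s, Arm i s, Arm i (\<not> s)]"]) (auto simp: mem_blade nbrs_sym[of _ T Top])
    qed
  qed
  obtain p where p: "distinct p" "set p \<subseteq> blade i" "p \<noteq> []"
    "successively (\<lambda>x y. y \<in> nbrs T x) (Top # p @ [Hub])" using path[OF assms(1)] by blast
  obtain q where q: "distinct q" "set q \<subseteq> blade j" "q \<noteq> []"
    "successively (\<lambda>x y. y \<in> nbrs T x) (Top # q @ [Hub])" using path[OF assms(2)] by blast
  have "successively (\<lambda>x y. y \<in> nbrs T x) (rev (Top # q @ [Hub]))"
    unfolding successively_rev using q(4) by (rule successively_mono) (simp add: nbrs_sym)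
  then have q': "successively (\<lambda>x y. y \<in> nbrs T x) (Hub # rev q @ [Top])" by simp
  show False
  proof (rule tree_graph_no_cycle[OF tree, of "(Top # p) @ (Hub # rev q)"])
    show "distinct ((Top # p) @ (Hub # rev q))"
      using p(1,2) q(1,2) assms(3) by (auto simp: mem_blade subset_iff)
    show "3 \<le> length ((Top # p) @ (Hub # rev q))" using p(3) by (cases p) auto
    show "successively (\<lambda>x y. y \<in> nbrs T x) ((Top # p) @ (Hub # rev q))"
      using p(3,4) q' q(3) by (auto simp: successively_append_iff successively_Cons)
    show "hd ((Top # p) @ (Hub # rev q)) \<in> nbrs T (last ((Top # p) @ (Hub # rev q)))"
      using q(3) q' by (auto simp: successively_append_iff successively_Cons)
  qed
qed

text \<open>If the tip on side \<open>s\<close> is not a leaf, the route runs straight down that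
  side. If it is, it is the only leaf of the blade, so the other tip and arm continue the path from
  \<open>Top\<close> to \<open>Hub\<close> or across to \<open>Arm i s\<close>, which is adjacent to
  \<open>Hub\<close>.\<close>

lemma linkedI:
  assumes "i < n" "blade i \<inter> D = {}" "Top \<notin> D" "leaves T \<inter> blade i \<subseteq> {x}" "Arm i s \<in> nbrs T Hub"
  shows "linked i"
proof (cases "Tip i s \<in> leaves T")
  case False
  have "Tip i s \<notin> D" using assms(2) by (auto simp: disjoint_iff mem_blade)
  then show ?thesis
    using Tip_nonleaf[of i s] False assms nbrs_symD[OF assms(5)] unfolding linked_def by blast
next
  case True
  have notin: "Tip i r \<notin> D" "Arm i r \<notin> D" for r using assms(2) by (auto simp: disjoint_iff mem_blade)
  have "x = Tip i s" using True assms(4) by (auto simp: mem_blade subset_iff)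
  then have nl: "Tip i (\<not> s) \<notin> leaves T" "Arm i (\<not> s) \<notin> leaves T"
    using assms(4) by (auto simp: mem_blade subset_iff)
  have "Top \<in> nbrs T (Tip i (\<not> s))" "Arm i (\<not> s) \<in> nbrs T (Tip i (\<not> s))"
    using Tip_nonleaf[OF assms(1) notin(1) assms(3) nl(1)] .
  moreover have "Hub \<in> nbrs T (Arm i (\<not> s)) \<or> Arm i s \<in> nbrs T (Arm i (\<not> s))"
    using Arm_nonleaf[OF assms(1) notin(2) assms(3) nl(2)] by simp
  moreover have "Hub \<in> nbrs T (Arm i s)" using nbrs_symD[OF assms(5)] .
  ultimately show ?thesis
    unfolding linked_def by (intro exI[of _ "\<not> s"]) auto
qed

lemma blade_leaf:
  assumes "i < n" "blade i \<inter> D = {}" "Top \<notin> D"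
  shows "\<exists>x. x \<in> leaves T \<and> x \<in> blade i"
proof (rule ccontr)
  assume none: "\<not> ?thesis"
  have notin: "Tip i r \<notin> D" "Arm i r \<notin> D" for r using assms(2) by (auto simp: disjoint_iff mem_blade)
  have nl: "Tip i r \<notin> leaves T" "Arm i r \<notin> leaves T" for r using none unfolding mem_blade by blast+
  have t: "Top \<in> nbrs T (Tip i r)" "Arm i r \<in> nbrs T (Tip i r)" for r
    using Tip_nonleaf[OF assms(1) notin(1) assms(3) nl(1)] by blast+
  note tip = t t[THEN nbrs_symD]
  show False
  proof (cases "Arm i False \<in> nbrs T (Arm i True)")
    case True
    then show False
      using tree_graph_no_cycle[OF tree, of "[Top, Tip i True, Arm i True, Arm i False, Tip i False]"] tip
      by simp
  next
    case False
    then have "Arm i True \<notin> nbrs T (Arm i False)" by (auto dest: nbrs_symD)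
    with False have "Hub \<in> nbrs T (Arm i True)" "Hub \<in> nbrs T (Arm i False)"
      using Arm_nonleaf[OF assms(1) notin(2) assms(3) nl(2)] by force+
    then have "Hub \<in> nbrs T (Arm i True)" "Arm i False \<in> nbrs T Hub" by (auto dest: nbrs_symD)
    then show False
      using tree_graph_no_cycle[OF tree, of "[Top, Tip i True, Arm i True, Hub, Arm i False, Tip i False]"] tip
      by simp
  qed
qed

text \<open>Distinct intact blades supply distinct leaves \<open>f i\<close>, in addition to known
  leaves \<open>X\<close> outside them. The last clause is the equality case: an optimal tree has no
  other leaves.\<close>

lemma leaves_count:
  assumes I: "I \<subseteq> {..<n}" "\<And>i. i \<in> I \<Longrightarrow> blade i \<inter> D = {}" "Top \<notin> D"
    and X: "X \<subseteq> leaves T" "\<And>i. i \<in> I \<Longrightarrow> blade i \<inter> X = {}"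
  obtains f where "\<forall>i\<in>I. f i \<in> blade i" "X \<union> f ` I \<subseteq> leaves T" "card X + card I \<le> card (leaves T)"
    "card (leaves T) \<le> card X + card I \<longrightarrow> leaves T = X \<union> f ` I"
proof -
  have "\<forall>i\<in>I. \<exists>x. x \<in> leaves T \<and> x \<in> blade i" using blade_leaf I by blast
  then obtain f where f: "\<forall>i\<in>I. f i \<in> leaves T \<and> f i \<in> blade i" by metis
  have fin: "finite I" "finite X" "finite (leaves T)"
    using finite_subset[OF I(1)] finite_leaves[OF simple] finite_subset[OF X(1)] by auto
  have "inj_on f I" using f by (intro inj_onI) (metis mem_blade vertex.inject vertex.distinct)
  moreover have "X \<inter> f ` I = {}" using f X(2) by blast
  ultimately have card: "card (X \<union> f ` I) = card X + card I"
    using fin by (simp add: card_Un_disjoint card_image)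
  have sub: "X \<union> f ` I \<subseteq> leaves T" using f X(1) by blast
  show thesis
    by (rule that[of f]) (use f sub card card_mono[OF fin(3) sub] card_seteq[OF fin(3) sub] in auto)
qed

end

section \<open>Lower bounds for the number of leaves after each deletion\<close>

context windmill_spanning_tree
begin

lemma leaves_lower:
  assumes "Top \<notin> D" "\<And>i. i < n \<Longrightarrow> blade i \<inter> D = {}"
  shows "n \<le> card (leaves T)"
  by (rule leaves_count[of "{..<n}" "{}"]) (use assms in auto)

text \<open>The intact blades and \<open>X\<close> account for one leaf fewer. If there were no
  more, \<open>Hub\<close> would not be a leaf and would have a neighbour in another blade; that
  blade has a single leaf, hence is linked, next to the linked blade \<open>j\<close>.\<close>

lemma linked_excess:
  assumes D: "Top \<notin> D" "Hub \<notin> D" "\<And>i. i < n \<Longrightarrow> i \<noteq> j \<Longrightarrow> blade i \<inter> D = {}"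
    and j: "j < n" "linked j" "nbrs T Hub \<inter> blade j \<subseteq> {y}"
    and X: "X \<subseteq> leaves T" "X \<subseteq> blade j"
  shows "card X + n \<le> card (leaves T)"
proof (rule ccontr)
  let ?I = "{..<n} - {j}"
  assume "\<not> ?thesis"
  then have le: "card (leaves T) \<le> card X + card ?I" using j(1) by simp
  obtain f where f: "\<forall>i\<in>?I. f i \<in> blade i" "X \<union> f ` ?I \<subseteq> leaves T" "card X + card ?I \<le> card (leaves T)"
    and eq: "card (leaves T) \<le> card X + card ?I \<longrightarrow> leaves T = X \<union> f ` ?I"
    by (rule leaves_count[of ?I X]) (use D X in \<open>auto simp: mem_blade disjoint_iff\<close>)
  have leaves: "leaves T = X \<union> f ` ?I" using eq le by blast
  then have leaf_blade: "\<exists>i. x \<in> blade i" if "x \<in> leaves T" for x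
    using that f(1) X(2) by blast
  have "Hub \<notin> blade i" for i by (simp add: mem_blade)
  then have Hub: "Hub \<notin> leaves T" using leaf_blade by blast
  have "card (nbrs T Hub) \<ge> 2"
    by (rule nonleaf[of _ Top]) (use D Hub in \<open>auto simp: verts_T\<close>)
  then have "\<not> nbrs T Hub \<subseteq> {y}" using card_mono[of "{y}" "nbrs T Hub"] by auto
  then obtain x where x: "x \<in> nbrs T Hub" "x \<noteq> y" by blast
  then obtain i s where i: "x = Arm i s" "i < n" using nbrs_T[of Hub] by auto
  have "x \<in> blade i" by (simp add: i mem_blade)
  then have "i \<noteq> j" using x j(3) by blast
  have one: "leaves T \<inter> blade i \<subseteq> {f i}"
  proof
    fix z assume z: "z \<in> leaves T \<inter> blade i"
    then have "z \<notin> X" using X(2) \<open>i \<noteq> j\<close> blade_unique by blast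
    then obtain l where "l \<in> ?I" "z = f l" using z leaves by blast
    moreover from this have "l = i" using f(1) z blade_unique by blast
    ultimately show "z \<in> {f i}" by simp
  qed
  have "linked i"
    by (rule linkedI[OF i(2) D(3)[OF i(2) \<open>i \<noteq> j\<close>] D(1) one]) (use x(1) i(1) in simp)
  with \<open>i \<noteq> j\<close>
  show False using not_linked_twice j(2) by blast
qed

text \<open>If the damaged blade has no leaf, the tree runs through it as \<open>Top\<close>, tip,
  arm, arm, \<open>Hub\<close>, and \<open>linked_excess\<close> yields the missing leaf.\<close>

lemma leaves_lower_Tip:
  assumes "D = {Tip j s}" "j < n"
  shows "n \<le> card (leaves T)"
proof (cases "\<exists>x. x \<in> leaves T \<and> x \<in> blade j")
  case True
  then obtain x where x: "x \<in> leaves T" "x \<in> blade j" by blast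
  obtain f where "card {x} + card ({..<n} - {j}) \<le> card (leaves T)"
    by (rule leaves_count[of "{..<n} - {j}" "{x}"]) (use x assms in \<open>auto simp: mem_blade disjoint_iff\<close>)
  then show ?thesis using assms(2) by simp
next
  case False
  then have nl: "Tip j r \<notin> leaves T" "Arm j r \<notin> leaves T" for r by (auto simp: mem_blade)
  have tip: "Top \<in> nbrs T (Tip j (\<not> s))" "Arm j (\<not> s) \<in> nbrs T (Tip j (\<not> s))"
    by (rule Tip_nonleaf; use assms nl in simp)+
  have "card (nbrs T (Arm j s)) \<ge> 2"
    by (rule nonleaf[of _ Top]) (use assms nl in \<open>auto simp: verts_T\<close>)
  then have arm: "nbrs T (Arm j s) = {Hub, Arm j (\<not> s)}"
    by (rule nonleaf_two) (use nbrs_T[of "Arm j s"] assms in auto)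
  then have arm': "Arm j s \<in> nbrs T (Arm j (\<not> s))" "Arm j s \<in> nbrs T Hub" "Hub \<in> nbrs T (Arm j s)"
    by (auto intro: nbrs_symD)
  have linked: "linked j" unfolding linked_def by (intro exI[of _ "\<not> s"]) (use tip arm' in simp)
  have not_Hub: "Arm j (\<not> s) \<notin> nbrs T Hub"
  proof
    assume "Arm j (\<not> s) \<in> nbrs T Hub"
    then show False
      using tree_graph_no_cycle[OF tree, of "[Hub, Arm j (\<not> s), Arm j s]"] arm' by auto
  qed
  have one: "nbrs T Hub \<inter> blade j \<subseteq> {Arm j s}"
  proof
    fix x assume x: "x \<in> nbrs T Hub \<inter> blade j"
    then obtain r where r: "x = Arm j r" using nbrs_T[of Hub] by (auto simp: mem_blade)
    then have "r \<noteq> (\<not> s)" using x not_Hub by blast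
    then show "x \<in> {Arm j s}" using r by simp
  qed
  have "card ({} :: vertex set) + n \<le> card (leaves T)"
    by (rule linked_excess[OF _ _ _ assms(2) linked one])
       (use assms in \<open>auto simp: mem_blade disjoint_iff\<close>)
  then show ?thesis by simp
qed

text \<open>The tip above the lost arm hangs from \<open>Top\<close> alone and is a leaf. On the
  other side there is either a second leaf or a straight route to \<open>Hub\<close>, in which case
  \<open>linked_excess\<close> applies.\<close>

lemma leaves_lower_Arm:
  assumes "D = {Arm j s}" "j < n"
  shows "n + 1 \<le> card (leaves T)"
proof -
  have "Tip j s \<in> verts T" "Top \<in> verts T" using assms by (simp_all add: verts_T)
  then have "nbrs T (Tip j s) \<noteq> {}" by (rule nbrs_nonempty) simp
  moreover have "nbrs T (Tip j s) \<subseteq> {Top}" using nbrs_T[of "Tip j s"] assms by auto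
  ultimately have "nbrs T (Tip j s) = {Top}" by blast
  then have leaf: "Tip j s \<in> leaves T" using \<open>Tip j s \<in> verts T\<close> by (simp add: mem_leaves[OF simple])
  show ?thesis
  proof (cases "\<exists>x. x \<in> leaves T \<and> x \<in> blade j \<and> x \<noteq> Tip j s")
    case True
    then obtain x where x: "x \<in> leaves T" "x \<in> blade j" "x \<noteq> Tip j s" by blast
    obtain f where "card {x, Tip j s} + card ({..<n} - {j}) \<le> card (leaves T)"
      by (rule leaves_count[of "{..<n} - {j}" "{x, Tip j s}"])
         (use x leaf assms in \<open>auto simp: mem_blade disjoint_iff\<close>)
    then show ?thesis using assms(2) x(3) by simp
  next
    case False
    then have nl: "Tip j (\<not> s) \<notin> leaves T" "Arm j (\<not> s) \<notin> leaves T" by (auto simp: mem_blade)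
    have tip: "Top \<in> nbrs T (Tip j (\<not> s))" "Arm j (\<not> s) \<in> nbrs T (Tip j (\<not> s))"
      by (rule Tip_nonleaf; use assms nl in simp)+
    have "Hub \<in> nbrs T (Arm j (\<not> s)) \<or> Arm j (\<not> \<not> s) \<in> nbrs T (Arm j (\<not> s))"
      by (rule Arm_nonleaf) (use assms nl in auto)
    then have "Hub \<in> nbrs T (Arm j (\<not> s))" using nbrs_T[of "Arm j (\<not> s)"] assms by auto
    then have linked: "linked j" unfolding linked_def by (intro exI[of _ "\<not> s"]) (use tip in simp)
    have one: "nbrs T Hub \<inter> blade j \<subseteq> {Arm j (\<not> s)}"
      using nbrs_T[of Hub] assms by (auto simp: mem_blade)
    have "card {Tip j s} + n \<le> card (leaves T)"
      by (rule linked_excess[OF _ _ _ assms(2) linked one])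
         (use assms leaf in \<open>auto simp: mem_blade disjoint_iff\<close>)
    then show ?thesis by simp
  qed
qed

lemma Tip_leaf_without_Top:
  assumes "D = {Top}" "i < n"
  shows "nbrs T (Tip i s) = {Arm i s}"
proof -
  have "Tip i s \<in> verts T" "Hub \<in> verts T" using assms by (simp_all add: verts_T)
  then have "nbrs T (Tip i s) \<noteq> {}" by (rule nbrs_nonempty) simp
  moreover have "nbrs T (Tip i s) \<subseteq> {Arm i s}" using nbrs_T[of "Tip i s"] assms by auto
  ultimately show ?thesis by blast
qed

lemma leaves_lower_Top:
  assumes "D = {Top}"
  shows "2 * n \<le> card (leaves T)"
proof -
  have "case_prod Tip ` ({..<n} \<times> UNIV) \<subseteq> leaves T"
    using Tip_leaf_without_Top[OF assms] assms by (auto simp: mem_leaves[OF simple] verts_T)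
  then have "card (case_prod Tip ` ({..<n} \<times> (UNIV :: bool set))) \<le> card (leaves T)"
    using finite_leaves[OF simple] by (intro card_mono)
  moreover have "inj_on (case_prod Tip) ({..<n} \<times> (UNIV :: bool set))" by (auto simp: inj_on_def)
  ultimately show ?thesis by (simp add: card_image card_cartesian_product)
qed

end

section \<open>Optimal trees of the windmill and of its vertex-deleted subgraphs\<close>

lemma ml_subgraphs_windmill_minus:
  assumes "n \<ge> 2" "D \<subseteq> {v}" "spanning_tree T\<^sub>0 (windmill_minus n D)" "leaves T\<^sub>0 \<subseteq> L"
    "finite L" "card L \<le> m"
    and "\<And>T. windmill_spanning_tree n D T \<Longrightarrow> m \<le> card (leaves T)"
  shows "ml_subgraphs (windmill_minus n D) = {T. spanning_tree T (windmill_minus n D) \<and> card (leaves T) = m}"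
    and "T\<^sub>0 \<in> ml_subgraphs (windmill_minus n D)"
proof -
  have "card (leaves T\<^sub>0) \<le> m" using card_mono[OF assms(5,4)] assms(6) by simp
  have lower: "m \<le> card (leaves T)" if "spanning_tree T (windmill_minus n D)" for T
    using assms(7) that by (simp add: windmill_spanning_tree_def)
  show *:
    "ml_subgraphs (windmill_minus n D) = {T. spanning_tree T (windmill_minus n D) \<and> card (leaves T) = m}"
    by (rule ml_subgraphs_eq[OF not_hamiltonian_windmill_minus[OF assms(1,2)] assms(3)
          \<open>card (leaves T\<^sub>0) \<le> m\<close> lower])
  show "T\<^sub>0 \<in> ml_subgraphs (windmill_minus n D)"
    unfolding * using assms(3) \<open>card (leaves T\<^sub>0) \<le> m\<close> lower[OF assms(3)] by simp
qed

lemma card_Tip_image: "card ((\<lambda>i. Tip i (d i)) ` {..<n}) = n"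
  by (subst card_image) (auto simp: inj_on_def)

context
  fixes n :: nat
  assumes n: "n \<ge> 2"
begin

text \<open>A spider centred at \<open>Top\<close>: leg \<open>i\<close> runs around blade
  \<open>i\<close> from \<open>Tip i True\<close> to \<open>Tip i False\<close>, and leg 0 visits
  \<open>Hub\<close> between its two arms. Apart from \<open>Top\<close> and the leaves all degrees
  are 2, so most failures need only a local repair.\<close>

definition base_tree :: "vertex ugraph" where
  "base_tree = windmill_tree n {} 0 {0} (\<lambda>_. True)"

lemma card_nbrs_base_tree:
  assumes "x \<in> verts (windmill n)"
  shows "card (nbrs base_tree x) = (case x of Top \<Rightarrow> n | Tip i s \<Rightarrow> if s then 2 else 1 | _ \<Rightarrow> 2)"
  using assms n card_Tip_image[of "\<lambda>_. True" n] unfolding base_tree_def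
  by (cases x) (auto simp: nbrs_windmill_tree)

lemma base_tree:
  shows "spanning_tree base_tree (windmill_minus n {})"
    and "ml_subgraphs (windmill_minus n {}) = {T. spanning_tree T (windmill_minus n {}) \<and> card (leaves T) = n}"
    and "base_tree \<in> ml_subgraphs (windmill_minus n {})"
proof -
  show T: "spanning_tree base_tree (windmill_minus n {})"
    unfolding base_tree_def by (rule spanning_windmill_tree) (use n in auto)
  let ?L = "(\<lambda>i. Tip i False) ` {..<n}"
  have "leaves base_tree \<subseteq> ?L"
  proof (rule leaves_subsetI[OF T])
    fix x assume "x \<in> verts (windmill_minus n {})" "card (nbrs base_tree x) = 1"
    then show "x \<in> ?L" using n by (cases x) (auto simp: card_nbrs_base_tree split: if_splits)
  qed
  note * = ml_subgraphs_windmill_minus[OF n empty_subsetI T this]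
  have "n \<le> card (leaves T)" if "windmill_spanning_tree n {} T" for T
    by (rule windmill_spanning_tree.leaves_lower[OF that]) auto
  with * show "ml_subgraphs (windmill_minus n {}) = {T. spanning_tree T (windmill_minus n {}) \<and> card (leaves T) = n}"
    "base_tree \<in> ml_subgraphs (windmill_minus n {})"
    by (auto simp: card_Tip_image)
qed


lemma cost_le_card:
  assumes "simple_graph T" "finite E"
    and "\<And>x. x \<in> verts (windmill n) \<Longrightarrow> x \<noteq> v \<Longrightarrow> card (nbrs T x) \<noteq> card (nbrs base_tree x) \<Longrightarrow> x \<in> E"
  shows "transition_cost (windmill n) v base_tree T \<le> card E"
proof -
  have "{w \<in> verts (windmill n) - {v}. card (nbrs base_tree w) \<noteq> card (nbrs T w)} \<subseteq> E"
    using assms(3) by auto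
  then show ?thesis
    unfolding transition_cost_nbrs[OF spanning_treeD(2)[OF base_tree(1)] assms(1)]
    by (rule card_mono[OF assms(2)])
qed

text \<open>Leg 0 uses the edge between its arms instead of the detour through \<open>Hub\<close>.
  No degree changes, so the cost is 0.\<close>

lemma delete_Hub:
  "\<exists>T\<in>ml_subgraphs (windmill_minus n {Hub}). transition_cost (windmill n) Hub base_tree T \<le> n + 1"
proof -
  define T where "T = windmill_tree n {Hub} 0 {} (\<lambda>_. True)"
  have T: "spanning_tree T (windmill_minus n {Hub})"
    unfolding T_def
  proof (rule spanning_windmill_tree)
    fix v assume "v \<in> verts (windmill n)" "v \<noteq> Top" "v \<notin> {Hub}"
    then show "parent 0 {} (\<lambda>_. True) v \<notin> {Hub}" by (cases v) auto
  qed (use n in auto)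
  have card: "card (nbrs T x) = card (nbrs base_tree x)" if "x \<in> verts (windmill n)" "x \<noteq> Hub" for x
    using that n card_Tip_image[of "\<lambda>_. True" n] card_nbrs_base_tree[OF that(1)] unfolding T_def
    by (cases x) (auto simp: nbrs_windmill_tree image_iff)
  have "leaves T \<subseteq> (\<lambda>i. Tip i False) ` {..<n}"
  proof (rule leaves_subsetI[OF T])
    fix x assume x: "x \<in> verts (windmill_minus n {Hub})" "card (nbrs T x) = 1"
    then have "card (nbrs base_tree x) = 1" using card by simp
    with x(1) n show "x \<in> (\<lambda>i. Tip i False) ` {..<n}"
      by (cases x) (auto simp: card_nbrs_base_tree split: if_splits)
  qed
  then have "T \<in> ml_subgraphs (windmill_minus n {Hub})"
    by (rule ml_subgraphs_windmill_minus(2)[OF n subset_refl T])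
       (auto simp: card_Tip_image mem_blade intro: windmill_spanning_tree.leaves_lower)
  moreover have "transition_cost (windmill n) Hub base_tree T \<le> card ({} :: vertex set)"
    by (rule cost_le_card[OF spanning_treeD(2)[OF T]]) (use card in auto)
  ultimately show ?thesis by force
qed

text \<open>Leg \<open>j\<close> now starts at the surviving tip and ends at the arm next to the
  lost one. Only these two vertices can change degree.\<close>

lemma delete_Tip:
  assumes "j < n"
  shows "\<exists>T\<in>ml_subgraphs (windmill_minus n {Tip j s}).
    transition_cost (windmill n) (Tip j s) base_tree T \<le> n + 1"
proof -
  define d where "d = (\<lambda>_. True)(j := \<not> s)"
  define T where "T = windmill_tree n {Tip j s} 0 {0} d"
  have T: "spanning_tree T (windmill_minus n {Tip j s})"
    unfolding T_def
  proof (rule spanning_windmill_tree)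
    fix v show "parent 0 {0} d v \<notin> {Tip j s}" by (cases v) (auto simp: d_def)
  qed (use n in auto)
  have Top_nbrs: "(\<lambda>i. Tip i (d i)) ` {..<n} - {Tip j s} = (\<lambda>i. Tip i (d i)) ` {..<n}"
    by (auto simp: d_def)
  have card: "card (nbrs T x) = (case x of Top \<Rightarrow> n | Tip i r \<Rightarrow> if r = d i then 2 else 1
      | Arm i r \<Rightarrow> if i = j \<and> r = s then 1 else 2 | Hub \<Rightarrow> 2)"
    if "x \<in> verts (windmill n)" "x \<noteq> Tip j s" for x
  proof (cases x)
    case Top
    then show ?thesis using n by (simp add: T_def nbrs_windmill_tree Top_nbrs card_Tip_image)
  qed (use that n assms in \<open>auto simp: T_def nbrs_windmill_tree d_def\<close>)
  let ?L = "(\<lambda>i. if i = j then Arm j s else Tip i False) ` {..<n}"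
  have "leaves T \<subseteq> ?L"
  proof (rule leaves_subsetI[OF T])
    fix x assume "x \<in> verts (windmill_minus n {Tip j s})" "card (nbrs T x) = 1"
    then show "x \<in> ?L"
      using n assms by (cases x) (auto simp: card d_def image_iff split: if_splits)
  qed
  moreover have "card ?L \<le> card {..<n}" by (rule card_image_le) simp
  ultimately have "T \<in> ml_subgraphs (windmill_minus n {Tip j s})"
    using windmill_spanning_tree.leaves_lower_Tip[OF _ refl assms]
    by (intro ml_subgraphs_windmill_minus(2)[OF n subset_refl T, where m = n and L = ?L]) auto
  moreover have "transition_cost (windmill n) (Tip j s) base_tree T \<le> card {Tip j (\<not> s), Arm j s}"
  proof (rule cost_le_card[OF spanning_treeD(2)[OF T]])
    fix x assume x: "x \<in> verts (windmill n)" "x \<noteq> Tip j s" "card (nbrs T x) \<noteq> card (nbrs base_tree x)"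
    show "x \<in> {Tip j (\<not> s), Arm j s}"
      using x(2,3) unfolding card[OF x(1,2)] card_nbrs_base_tree[OF x(1)]
      by (cases x) (auto simp: d_def split: if_splits)
  qed simp
  then have "transition_cost (windmill n) (Tip j s) base_tree T \<le> n + 1" using n by simp
  ultimately show ?thesis by blast
qed

text \<open>The tip above the lost arm becomes a leg of length 1, and the other side of blade
  \<open>j\<close> hangs from \<open>Hub\<close>, which another leg \<open>c\<close> visits. Only
  \<open>Hub\<close>, now of degree 3, and \<open>Tip j True\<close> can change degree.\<close>

lemma delete_Arm:
  assumes "j < n"
  shows "\<exists>T\<in>ml_subgraphs (windmill_minus n {Arm j s}).
    transition_cost (windmill n) (Arm j s) base_tree T \<le> n + 1"
proof -
  define d where "d = (\<lambda>_. True)(j := s)"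
  obtain c where c: "c < n" "c \<noteq> j"
  proof
    show "(if j = 0 then 1 else 0) < n" "(if j = 0 then 1 else 0) \<noteq> j" using n by auto
  qed
  define T where "T = windmill_tree n {Arm j s} c {c, j} d"
  have T: "spanning_tree T (windmill_minus n {Arm j s})"
    unfolding T_def
  proof (rule spanning_windmill_tree)
    fix v assume "v \<in> verts (windmill n)" "v \<noteq> Top" "v \<notin> {Arm j s}"
    then show "parent c {c, j} d v \<notin> {Arm j s}" using c by (cases v) (auto simp: d_def)
  qed (use c in auto)
  have Top_nbrs: "(\<lambda>i. Tip i (d i)) ` {..<n} - {Arm j s} = (\<lambda>i. Tip i (d i)) ` {..<n}"
    by auto
  have card: "card (nbrs T x) = (case x of Top \<Rightarrow> n | Tip i r \<Rightarrow> if r = d i \<and> i \<noteq> j then 2 else 1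
      | Arm i r \<Rightarrow> 2 | Hub \<Rightarrow> 3)"
    if x: "x \<in> verts (windmill n)" "x \<noteq> Arm j s" for x
  proof (cases x)
    case Top
    then show ?thesis using c by (simp add: T_def nbrs_windmill_tree Top_nbrs card_Tip_image)
  next
    case Hub
    have "nbrs T Hub = {Arm c True, Arm c False, Arm j (\<not> s)}"
      using c assms unfolding T_def by (auto simp: nbrs_windmill_tree d_def)
    then show ?thesis using c Hub by simp
  qed (use x c assms in \<open>auto simp: T_def nbrs_windmill_tree d_def\<close>)
  let ?L = "insert (Tip j True) ((\<lambda>i. Tip i False) ` {..<n})"
  have "leaves T \<subseteq> ?L"
  proof (rule leaves_subsetI[OF T])
    fix x assume "x \<in> verts (windmill_minus n {Arm j s})" "card (nbrs T x) = 1"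
    then show "x \<in> ?L"
      using n assms by (cases x) (auto simp: card d_def image_iff split: if_splits)
  qed
  then have "T \<in> ml_subgraphs (windmill_minus n {Arm j s})"
    by (rule ml_subgraphs_windmill_minus(2)[OF n subset_refl T, where m = "n + 1"])
       (use assms windmill_spanning_tree.leaves_lower_Arm in \<open>auto simp: card_insert_if card_Tip_image\<close>)
  moreover have "transition_cost (windmill n) (Arm j s) base_tree T \<le> card {Hub, Tip j True}"
  proof (rule cost_le_card[OF spanning_treeD(2)[OF T]])
    fix x assume x: "x \<in> verts (windmill n)" "x \<noteq> Arm j s" "card (nbrs T x) \<noteq> card (nbrs base_tree x)"
    note ne = x(3)[unfolded card[OF x(1,2)] card_nbrs_base_tree[OF x(1)]]
    show "x \<in> {Hub, Tip j True}"
    proof (cases x)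
      case (Tip i r)
      then show ?thesis using ne by (cases "i = j"; cases r) (simp_all add: d_def)
    qed (use ne in simp_all)
  qed simp
  then have "transition_cost (windmill n) (Arm j s) base_tree T \<le> n + 1" using n by simp
  ultimately show ?thesis by blast
qed

lemma ml_subgraphs_delete_Top:
  shows "ml_subgraphs (windmill_minus n {Top}) =
      {T. spanning_tree T (windmill_minus n {Top}) \<and> card (leaves T) = 2 * n}"
    and "top_tree n \<in> ml_subgraphs (windmill_minus n {Top})"
proof -
  let ?L = "case_prod Tip ` ({..<n} \<times> (UNIV :: bool set))"
  have Hub: "card (nbrs (top_tree n) Hub) = 2 * n"
    unfolding nbrs_top_tree_Hub by (subst card_image) (auto simp: inj_on_def card_cartesian_product)
  have "leaves (top_tree n) \<subseteq> ?L"
  proof (rule leaves_subsetI[OF spanning_top_tree])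
    fix x assume "x \<in> verts (windmill_minus n {Top})" "card (nbrs (top_tree n) x) = 1"
    then show "x \<in> ?L" using n Hub by (cases x) (auto simp: nbrs_top_tree_Arm)
  qed
  note * = ml_subgraphs_windmill_minus[OF n subset_refl spanning_top_tree this]
  have "card ?L \<le> 2 * n"
    using card_image_le[of "{..<n} \<times> (UNIV :: bool set)" "case_prod Tip"] by (simp add: card_cartesian_product)
  moreover have "2 * n \<le> card (leaves T)" if "windmill_spanning_tree n {Top} T" for T
    by (rule windmill_spanning_tree.leaves_lower_Top[OF that]) simp
  ultimately show "ml_subgraphs (windmill_minus n {Top}) =
      {T. spanning_tree T (windmill_minus n {Top}) \<and> card (leaves T) = 2 * n}"
    "top_tree n \<in> ml_subgraphs (windmill_minus n {Top})"
    using * by auto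
qed

text \<open>From the spider at \<open>Top\<close> to the one at \<open>Hub\<close> all arms keep
  degree 2; the changes are at \<open>Hub\<close> and at the \<open>n\<close> tips where the legs
  began.\<close>

lemma delete_Top:
  "\<exists>T\<in>ml_subgraphs (windmill_minus n {Top}). transition_cost (windmill n) Top base_tree T \<le> n + 1"
proof -
  let ?E = "insert Hub ((\<lambda>i. Tip i True) ` {..<n})"
  have "transition_cost (windmill n) Top base_tree (top_tree n) \<le> card ?E"
  proof (rule cost_le_card[OF spanning_treeD(2)[OF spanning_top_tree]])
    fix x assume "x \<in> verts (windmill n)" "x \<noteq> Top"
      "card (nbrs (top_tree n) x) \<noteq> card (nbrs base_tree x)"
    then show "x \<in> ?E"
      by (cases x) (auto simp: card_nbrs_base_tree nbrs_top_tree_Arm nbrs_top_tree_Tip split: if_splits)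
  qed simp
  also have "card ?E \<le> n + 1" by (simp add: card_insert_if card_Tip_image)
  finally show ?thesis using ml_subgraphs_delete_Top(2) by blast
qed

lemma delete_vertex:
  assumes "v \<in> verts (windmill n)"
  shows "\<exists>T\<in>ml_subgraphs (windmill_minus n {v}). transition_cost (windmill n) v base_tree T \<le> n + 1"
proof (cases v)
  case Top
  then show ?thesis using delete_Top by simp
next
  case Hub
  then show ?thesis using delete_Hub by simp
next
  case (Tip j s)
  then show ?thesis using delete_Tip[of j s] assms by simp
next
  case (Arm j s)
  then show ?thesis using delete_Arm[of j s] assms by simp
qed

lemma delete_Top_lower:
  assumes S: "S \<in> ml_subgraphs (windmill n)" and S': "S' \<in> ml_subgraphs (windmill_minus n {Top})"
  shows "n + 1 \<le> transition_cost (windmill n) Top S S'"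
proof -
  have "spanning_tree S (windmill_minus n {})" and card_leaves: "card (leaves S) = n"
    using S base_tree(2) by (auto simp: windmill_minus_empty)
  then interpret S: windmill_spanning_tree n "{}" S by unfold_locales
  interpret S': windmill_spanning_tree n "{Top}" S'
    using S' ml_subgraphs_delete_Top(1) by unfold_locales auto
  define E where "E = {w \<in> verts (windmill n) - {Top}. card (nbrs S w) \<noteq> card (nbrs S' w)}"
  have fin: "finite E" using finite_windmill by (auto simp: E_def)
  obtain f where f: "\<forall>i\<in>{..<n}. f i \<in> blade i" and leaves: "leaves S = f ` {..<n}"
    by (rule S.leaves_count[of "{..<n}" "{}"]) (use card_leaves in auto)
  \<comment> \<open>Blade \<open>i\<close> has the single leaf \<open>f i\<close> in
    \<open>S\<close>, so one of its tips, on side \<open>t i\<close>, is no leaf and becomes one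
    when \<open>Top\<close> fails. These are the first \<open>n\<close> changes.\<close>
  have "\<exists>s. Tip i s \<noteq> f i" for i by (metis vertex.inject(1))
  then obtain t where t: "\<And>i. Tip i (t i) \<noteq> f i" by metis
  have leaf_iff: "x \<in> leaves S \<longleftrightarrow> x = f i" if "x \<in> blade i" "i < n" for x i
    using that f leaves blade_unique[of x] by auto
  have nonleaf: "card (nbrs S x) \<noteq> 1" if "x \<in> blade i" "i < n" "x \<noteq> f i" for x i
    using that leaf_iff[OF that(1,2)] S.verts_T by (auto simp: mem_leaves[OF S.simple] mem_blade)
  have tip_card: "card (nbrs S' (Tip i s)) = 1" if "i < n" for i s
    using S'.Tip_leaf_without_Top[OF refl that] by simp
  have tE: "Tip i (t i) \<in> E" if "i < n" for i
    using nonleaf[of "Tip i (t i)" i] t tip_card that by (simp add: E_def mem_blade)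
  have "(\<lambda>i. Tip i (t i)) ` {..<n} \<subseteq> E" using tE by auto
  moreover have "\<not> E \<subseteq> (\<lambda>i. Tip i (t i)) ` {..<n}"
  proof
    assume sub: "E \<subseteq> (\<lambda>i. Tip i (t i)) ` {..<n}"
    \<comment> \<open>If nothing else changed, \<open>Hub\<close> and all arms would have the same
      degree in \<open>S\<close> and in \<open>S'\<close>.\<close>
    have same: "card (nbrs S x) = card (nbrs S' x)" if "x \<in> verts (windmill n)" "x \<noteq> Top"
      "x \<notin> (\<lambda>i. Tip i (t i)) ` {..<n}" for x
      using that sub by (auto simp: E_def)
    have "Hub \<in> verts S" "Top \<in> verts S" by (simp_all add: S.verts_T)
    then have "nbrs S Hub \<noteq> {}" by (rule S.nbrs_nonempty) simp
    then obtain i r where i: "Arm i r \<in> nbrs S Hub" "i < n" using S.nbrs_T[of Hub] by fastforce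
    have linked: "S.linked l" if "Arm l q \<in> nbrs S Hub" "l < n" for l q
    proof (rule S.linkedI[of _ "f l" q])
      show "leaves S \<inter> blade l \<subseteq> {f l}" using leaf_iff that(2) by blast
    qed (use that in auto)
    \<comment> \<open>In \<open>S\<close> every blade that touches \<open>Hub\<close> is linked, so
      there is just one. This bounds by 2 the degree of \<open>Hub\<close> and of the arms of any
      other blade \<open>j\<close>.\<close>
    then have only: "l = i" if "Arm l q \<in> nbrs S Hub" "l < n" for l q
      using S.not_linked_twice i that by blast
    obtain j where j: "j < n" "j \<noteq> i"
    proof
      show "(if i = 0 then 1 else 0) < n" "(if i = 0 then 1 else 0) \<noteq> i" using n by auto
    qed
    have "nbrs S Hub \<subseteq> {Arm i True, Arm i False}"
    proof
      fix x assume x: "x \<in> nbrs S Hub"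
      then obtain l q where "x = Arm l q" "l < n" using S.nbrs_T[of Hub] by auto
      with x only[of l q] show "x \<in> {Arm i True, Arm i False}" by (cases q) auto
    qed
    then have "card (nbrs S Hub) \<le> card {Arm i True, Arm i False}" by (intro card_mono) auto
    moreover have "card (nbrs S Hub) = card (nbrs S' Hub)" by (rule same) auto
    ultimately have Hub: "card (nbrs S' Hub) \<le> 2" by simp
    have arm: "card (nbrs S' (Arm j q)) \<le> 2" for q
    proof -
      have "Hub \<notin> nbrs S (Arm j q)" using only[of j q] j nbrs_symD by metis
      then have "nbrs S (Arm j q) \<subseteq> {Tip j q, Arm j (\<not> q)}" using S.nbrs_T[of "Arm j q"] j(1) by auto
      then have "card (nbrs S (Arm j q)) \<le> card {Tip j q, Arm j (\<not> q)}" by (intro card_mono) auto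
      moreover have "card (nbrs S (Arm j q)) = card (nbrs S' (Arm j q))" by (rule same) (use j(1) in auto)
      ultimately show ?thesis by simp
    qed
    have tip: "nbrs S' (Tip l q) = {Arm l q}" if "l < n" for l q
      by (rule S'.Tip_leaf_without_Top[OF refl that])
    have crossing: "\<exists>q. Hub \<in> nbrs S' (Arm l q)" if "l < n" for l
    proof (rule ccontr)
      assume none: "\<not> ?thesis"
      have "verts S' \<subseteq> blade l"
      proof (rule connected_graph_closed[OF S'.connected, of "Tip l True"])
        fix y assume "y \<in> blade l"
        then show "nbrs S' y \<subseteq> blade l"
          using tip[OF that] none S'.nbrs_T[of y] that by (auto simp: mem_blade)
      qed (use that in \<open>auto simp: mem_blade S'.verts_T\<close>)
      moreover have "Hub \<in> verts S'" by (simp add: S'.verts_T)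
      ultimately have "Hub \<in> blade l" by (rule subsetD)
      then show False by (simp add: mem_blade)
    qed
    obtain q where q: "Hub \<in> nbrs S' (Arm j q)" using crossing[OF j(1)] by blast
    have "Tip j q \<in> nbrs S' (Arm j q)" using tip[OF j(1), of q] nbrs_symD[of "Arm j q" S' "Tip j q"] by simp
    \<comment> \<open>The tip and \<open>Hub\<close> exhaust the degree of this arm, so the other
      side of blade \<open>j\<close> must reach \<open>Hub\<close> by itself.\<close>
    have no_chord: "Arm j (\<not> q) \<notin> nbrs S' (Arm j q)"
    proof
      assume "Arm j (\<not> q) \<in> nbrs S' (Arm j q)"
      then have "{Hub, Tip j q, Arm j (\<not> q)} \<subseteq> nbrs S' (Arm j q)"
        using q \<open>Tip j q \<in> nbrs S' (Arm j q)\<close> by blast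
      then have "card {Hub, Tip j q, Arm j (\<not> q)} \<le> card (nbrs S' (Arm j q))"
        by (rule card_mono[OF finite_nbrs[OF S'.simple]])
      then show False using arm[of q] by simp
    qed
    have q': "Hub \<in> nbrs S' (Arm j (\<not> q))"
    proof (rule ccontr)
      assume none: "\<not> ?thesis"
      have chord: "Arm j q \<notin> nbrs S' (Arm j (\<not> q))" using no_chord nbrs_symD by metis
      have "verts S' \<subseteq> {Tip j (\<not> q), Arm j (\<not> q)}"
      proof (rule connected_graph_closed[OF S'.connected, of "Tip j (\<not> q)"])
        fix y assume "y \<in> {Tip j (\<not> q), Arm j (\<not> q)}"
        then show "nbrs S' y \<subseteq> {Tip j (\<not> q), Arm j (\<not> q)}"
          using tip[OF j(1), of "\<not> q"] none chord S'.nbrs_T[of "Arm j (\<not> q)"] j(1) by auto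
      qed (use j(1) in \<open>auto simp: S'.verts_T\<close>)
      moreover have "Hub \<in> verts S'" by (simp add: S'.verts_T)
      ultimately have "Hub \<in> {Tip j (\<not> q), Arm j (\<not> q)}" by (rule subsetD)
      then show False by simp
    qed
    obtain q'' where q'': "Hub \<in> nbrs S' (Arm i q'')" using crossing[OF i(2)] by blast
    \<comment> \<open>Both arms of blade \<open>j\<close> and an arm of blade \<open>i\<close>
      exceed the degree 2 available at \<open>Hub\<close>.\<close>
    have "{Arm j q, Arm j (\<not> q), Arm i q''} \<subseteq> nbrs S' Hub"
      using q[THEN nbrs_symD] q'[THEN nbrs_symD] q''[THEN nbrs_symD] by blast
    then have "card {Arm j q, Arm j (\<not> q), Arm i q''} \<le> card (nbrs S' Hub)"
      by (rule card_mono[OF finite_nbrs[OF S'.simple]])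
    then show False using Hub j(2) by simp
  qed
  ultimately have "(\<lambda>i. Tip i (t i)) ` {..<n} \<subset> E" by blast
  then have "n < card E" using psubset_card_mono[OF fin] card_Tip_image[of t n] by metis
  then show ?thesis
    using transition_cost_nbrs[OF S.simple S'.simple] by (simp add: E_def)
qed

lemma fault_cost_windmill: "fault_cost (windmill n) = enat (n + 1)"
proof (rule fault_cost_eqI)
  show "base_tree \<in> ml_subgraphs (windmill n)"
    using base_tree(3) by (simp add: windmill_minus_empty)
next
  fix v assume "v \<in> verts (windmill n)"
  then show "\<exists>S'\<in>ml_subgraphs (windmill_minus n {v}). transition_cost (windmill n) v base_tree S' \<le> n + 1"
    by (rule delete_vertex)
next
  fix S assume "S \<in> ml_subgraphs (windmill n)"
  then show "\<exists>v\<in>verts (windmill n). \<forall>S'\<in>ml_subgraphs (windmill_minus n {v}).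
      n + 1 \<le> transition_cost (windmill n) v S S'"
    using delete_Top_lower by (intro bexI[of _ Top]) auto
qed

text \<open>The optimal trees found for each deletion are spanning trees and so already witness
  connectedness.\<close>

lemma k_connected_windmill: "k_connected 2 (windmill n)"
proof (rule two_connectedI[OF simple_windmill])
  have "card ((\<lambda>i. Tip i True) ` {..<n} \<union> {Top, Hub}) \<le> card (verts (windmill n))"
    by (intro card_mono finite_windmill) auto
  moreover have "card ((\<lambda>i. Tip i True) ` {..<n} \<union> {Top, Hub}) = n + 2"
    by (subst card_Un_disjoint) (auto simp: card_Tip_image)
  ultimately show "card (verts (windmill n)) > 2" using n by simp
  show "connected_graph (windmill n)"
    using spanning_tree_connected[OF base_tree(1)] by (simp add: windmill_minus_empty)
next
  fix v assume "v \<in> verts (windmill n)"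
  then obtain T where T: "T \<in> ml_subgraphs (windmill_minus n {v})"
    using delete_vertex by blast
  have "\<not> hamiltonian (windmill_minus n {v})" by (rule not_hamiltonian_windmill_minus[OF n subset_refl])
  with T have "spanning_tree T (windmill_minus n {v})" by (simp add: ml_subgraphs_def)
  then show "connected_graph (windmill_minus n {v})" by (rule spanning_tree_connected)
qed

end

lemma bij_vertex_nat: "bij (to_nat_on (UNIV :: vertex set))"
proof (rule to_nat_on_infinite)
  have "inj (\<lambda>i. Tip i True)" by (auto simp: inj_def)
  then show "infinite (UNIV :: vertex set)" by (meson finite_imageD finite_subset infinite_UNIV_nat subset_UNIV)
qed simp

theorem theorem6:
  fixes k :: nat
  shows "\<exists>G :: nat ugraph. simple_graph G \<and> k_connected 2 G \<and> fault_cost G = enat k"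
proof -
  consider "k = 0" | "k = 1" | "k = 2" | "k \<ge> 3" by linarith
  then show ?thesis
  proof cases
    case 1
    then show ?thesis
      by (intro exI[of _ "complete_graph {..<4}"])
         (simp add: simple_complete_graph k_connected_complete_graph fault_cost_complete_graph_4)
  next
    case 2
    then show ?thesis
      using simple_two_fragments k_connected_two_fragments fault_cost_two_fragments by blast
  next
    case 3
    then show ?thesis
      by (intro exI[of _ "complete_graph {..<3}"])
         (simp add: simple_complete_graph k_connected_complete_graph fault_cost_complete_graph_3)
  next
    case 4
    \<comment> \<open>A windmill with \<open>n\<close> blades has cost \<open>n + 1\<close>, so
      \<open>k - 1\<close> blades are taken; there must be at least two.\<close>
    then have "k - 1 \<ge> 2" and k: "k - 1 + 1 = k" by simp_all
    then show ?thesis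
      using fault_cost_transport[OF bij_vertex_nat simple_windmill k_connected_windmill
          fault_cost_windmill, of "k - 1"] by simp
  qed
qed

end
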